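(* Let $\tilde I\subset\mathbb{C}[\mathbf{z},\mathbf{w}]$ be the zero dimensional ideal described in the context, with $V(\tilde I)=\{(\mathbf{z}^{(1)},\mathbf{w}^{(1)}),\ldots,(\mathbf{z}^{(d)},\mathbf{w}^{(d)})\}$ (distinct points), and let $\xi\in\mathbb{C}[\mathbf{z},\mathbf{w}]$ satisfy $\xi=\xi^{\ast}$. Then: i) The variety $V(\tilde I)$ consists only of conjugated singles $(\mathbf{z}^{(k)},\bar{\mathbf{z}}^{(k)})$ with multiplicity $1$ such that $\xi(\mathbf{z}^{(k)},\bar{\mathbf{z}}^{(k)})>0$ if and only if $\mathcal{K}_{\mathbb{C}}^{\xi}$ is positive definite. ii) The rank of $\mathcal{K}_{\mathbb{C}}^{\xi}$ is the number of distinct points $(\mathbf{z}^{(k)},\mathbf{w}^{(k)})\in V(\tilde I)$ such that $\xi(\mathbf{z}^{(k)},\mathbf{w}^{(k)})\neq 0$. iii) The number of distinct conjugated singles $(\mathbf{z}^{(k)},\bar{\mathbf{z}}^{(k)})\in V(\tilde I)$ with $\xi(\mathbf{z}^{(k)},\bar{\mathbf{z}}^{(k)})>0$ minus the number of distinct conjugated singles $(\mathbf{z}^{(k)},\bar{\mathbf{z}}^{(k)})\in V(\tilde I)$ with $\xi(\mathbf{z}^{(k)},\bar{\mathbf{z}}^{(k)})<0$ equals the signature of $\mathcal{K}_{\mathbb{C}}^{\xi}$. If moreover the evaluations $\xi(\mathbf{z}^{(k)},\mathbf{w}^{(k)})$, $k=1,\ldots,d$, are pairwise different, then: iv) The number of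 distinct conjugated singles $(\mathbf{z}^{(k)},\bar{\mathbf{z}}^{(k)})\in V(\tilde I)$ with $\xi(\mathbf{z}^{(k)},\bar{\mathbf{z}}^{(k)})>0$ equals the number of positive eigenvalues of $\mathcal{K}_{\mathbb{C}}^{\xi}$ minus the number of negative eigenvalues of $\mathcal{K}_{\mathbb{C}}^{1}$. v) The number of distinct conjugated singles $(\mathbf{z}^{(k)},\bar{\mathbf{z}}^{(k)})\in V(\tilde I)$ with $\xi(\mathbf{z}^{(k)},\bar{\mathbf{z}}^{(k)})<0$ equals the number of negative eigenvalues of $\mathcal{K}_{\mathbb{C}}^{\xi}$ minus the number of negative eigenvalues of $\mathcal{K}_{\mathbb{C}}^{1}$.
   Context: Let $r,c\geq 1$, $\mathbf{z}=(z_1,\ldots,z_r)$, $\mathbf{w}=(w_1,\ldots,w_r)$. For $p(\mathbf{z},\mathbf{w})=\sum a_{\alpha,\beta}\mathbf{z}^{\alpha}\mathbf{w}^{\beta}\in\mathbb{C}[\mathbf{z},\mathbf{w}]$, $\bar p$ denotes the polynomial with conjugated coefficients: $\bar p(\mathbf{z},\mathbf{w})=\sum \bar a_{\alpha,\beta}\mathbf{z}^{\alpha}\mathbf{w}^{\beta}$; thus $\bar p(\mathbf{w},\mathbf{z})=\sum \bar a_{\alpha,\beta}\mathbf{w}^{\alpha}\mathbf{z}^{\beta}$. Given $p_1,\ldots,p_c\in\mathbb{C}[\mathbf{z},\mathbf{w}]$, set $$\tilde I=\langle p_1(\mathbf{z},\mathbf{w}),\ldots,p_c(\mathbf{z},\mathbf{w}),\bar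 p_1(\mathbf{w},\mathbf{z}),\ldots,\bar p_c(\mathbf{w},\mathbf{z})\rangle\subset\mathbb{C}[\mathbf{z},\mathbf{w}],$$ assumed zero dimensional, so its zero set $V(\tilde I)\subset\mathbb{C}^{2r}$ is finite with $d>0$ points. The multiplicity $m_k$ of a point of $V(\tilde I)$ is its usual multiplicity as a zero of $\tilde I$ (dimension of the local algebra), so $\dim(\mathbb{C}[\mathbf{z},\mathbf{w}]/\tilde I)=\sum_k m_k$. A point of $V(\tilde I)$ of the form $(\mathbf{z},\bar{\mathbf{z}})$ is called a conjugated single. The map $\ast$ on $\mathbb{C}[\mathbf{z},\mathbf{w}]$, $f\mapsto f^{\ast}$, is $f^{\ast}(\mathbf{z},\mathbf{w})=\bar f(\mathbf{w},\mathbf{z})$, i.e. it is the conjugate-linear ring involution with $z_k^{\ast}=w_k$, $w_k^{\ast}=z_k$, $a^{\ast}=\bar a$ for $a\in\mathbb{C}$; it preserves $\tilde I$ and passes to the quotient. For $g\in\mathbb{C}[\mathbf{z},\mathbf{w}]$, $M_g$ is the linear map $[f]\mapsto[fg]$ on $\mathbb{C}[\mathbf{z},\mathbf{w}]/\tilde I$. For $\xi=\xi^{\ast}$, $\mathcal{K}_{\mathbb{C}}^{\xi}$ is the Hermitian sesquilinear form on $\mathbb{C}[\mathbf{z},\mathbf{w}]/\tilde I$ given by $$\mathcal{K}_{\mathbb{C}}^{\xi}(f,g)=\operatorname{Tr}(M_{\xi}M_fM_{g^{\ast}}),$$ and $\mathcal{K}_{\mathbb{C}}^{1}$ is the case $\xi=1$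 (the Hermitian Killing form). Eigenvalues, counted with multiplicity, are those of a matrix representing the form in a basis (the number of positive and of negative ones does not depend on the basis); the signature is the number of positive minus the number of negative eigenvalues. *)

theory Defs
  imports
    "HOL-Library.Poly_Mapping"
    "HOL-Library.Complex_Order"
    "HOL-Computational_Algebra.Fraction_Field"
    "HOL-Computational_Algebra.Polynomial"
    "Jordan_Normal_Form.Char_Poly"
    "Jordan_Normal_Form.DL_Rank"
begin

text \<open>
  The variables are indexed by \<open>'r + 'r\<close>, where \<open>'r\<close> is a finite type with \<open>r\<close> elements:
  \<open>Inl k\<close> stands for \<open>z\<^sub>k\<close> and \<open>Inr k\<close> for \<open>w\<^sub>k\<close>.  The linear orders on \<open>'r\<close> and \<open>'r + 'r\<close>
  are only there because the library needs an ordered index type for the instance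
  \<open>poly_mapping :: idom\<close>, without which the fraction field of the polynomial ring is not available.
\<close>

instantiation sum :: (linorder, linorder) linorder
begin

definition less_eq_sum :: "'a + 'b \<Rightarrow> 'a + 'b \<Rightarrow> bool" where
  "x \<le> y \<longleftrightarrow>
     (case x of Inl a \<Rightarrow> (case y of Inl b \<Rightarrow> a \<le> b | Inr _ \<Rightarrow> True)
              | Inr a \<Rightarrow> (case y of Inl _ \<Rightarrow> False | Inr b \<Rightarrow> a \<le> b))"

definition less_sum :: "'a + 'b \<Rightarrow> 'a + 'b \<Rightarrow> bool" where
  "(x :: 'a + 'b) < y \<longleftrightarrow> x \<le> y \<and> \<not> y \<le> x"

instance
  by standard (auto simp: less_eq_sum_def less_sum_def split: sum.splits)

end

type_synonym 'r zw_poly = "('r + 'r \<Rightarrow>\<^sub>0 nat) \<Rightarrow>\<^sub>0 complex"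

type_synonym 'r point = "('r \<Rightarrow> complex) \<times> ('r \<Rightarrow> complex)"

definition const_poly :: "complex \<Rightarrow> 'r zw_poly" where
  "const_poly a = Poly_Mapping.single 0 a"

definition eval_zw :: "'r::finite point \<Rightarrow> 'r zw_poly \<Rightarrow> complex" where
  "eval_zw P f =
     (\<Sum>m\<in>Poly_Mapping.keys f. Poly_Mapping.lookup f m *
        ((\<Prod>k\<in>UNIV. fst P k ^ Poly_Mapping.lookup m (Inl k)) *
         (\<Prod>k\<in>UNIV. snd P k ^ Poly_Mapping.lookup m (Inr k))))"

definition conj_coeffs :: "'r zw_poly \<Rightarrow> 'r zw_poly" where
  "conj_coeffs f = Poly_Mapping.map cnj f"

definition swap_exponents :: "('r + 'r \<Rightarrow>\<^sub>0 nat) \<Rightarrow> ('r + 'r \<Rightarrow>\<^sub>0 nat)" where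
  "swap_exponents m = Poly_Mapping.map_key (case_sum Inr Inl) m"

definition swap_vars :: "'r zw_poly \<Rightarrow> 'r zw_poly" where
  "swap_vars f = Poly_Mapping.map_key swap_exponents f"

definition star :: "'r zw_poly \<Rightarrow> 'r zw_poly" where
  "star f = swap_vars (conj_coeffs f)"

lemma inj_case_sum_Inr_Inl: "inj (case_sum Inr Inl)"
  by (auto simp: inj_on_def split: sum.splits)

lemma lookup_swap_exponents:
  "Poly_Mapping.lookup (swap_exponents m) (Inl k) = Poly_Mapping.lookup m (Inr k)"
  "Poly_Mapping.lookup (swap_exponents m) (Inr k) = Poly_Mapping.lookup m (Inl k)"
  by (simp_all add: swap_exponents_def map_key.rep_eq[OF inj_case_sum_Inr_Inl])

lemma swap_exponents_swap_exponents [simp]: "swap_exponents (swap_exponents m) = m"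
proof (rule poly_mapping_eqI)
  show "Poly_Mapping.lookup (swap_exponents (swap_exponents m)) x = Poly_Mapping.lookup m x" for x
    by (cases x) (simp_all add: lookup_swap_exponents)
qed

lemma inj_swap_exponents: "inj swap_exponents"
  by (rule inj_on_inverseI[of _ swap_exponents]) simp

lemma lookup_star:
  "Poly_Mapping.lookup (star f) m = cnj (Poly_Mapping.lookup f (swap_exponents m))"
  by (simp add: star_def swap_vars_def conj_coeffs_def map_key.rep_eq[OF inj_swap_exponents]
      Poly_Mapping.map.rep_eq when_def)

definition ideal_generated :: "'a::comm_ring_1 set \<Rightarrow> 'a set" where
  "ideal_generated S = Modules.module.span (*) S"

definition tilde_ideal :: "nat \<Rightarrow> (nat \<Rightarrow> 'r zw_poly) \<Rightarrow> 'r zw_poly set" where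
  "tilde_ideal c p = ideal_generated (p ` {..<c} \<union> (\<lambda>i. star (p i)) ` {..<c})"

definition zero_set :: "'r::finite zw_poly set \<Rightarrow> 'r point set" where
  "zero_set I = {P. \<forall>f\<in>I. eval_zw P f = 0}"

definition conjugated_single :: "'r point \<Rightarrow> bool" where
  "conjugated_single P \<longleftrightarrow> snd P = (\<lambda>k. cnj (fst P k))"

text \<open>
  The quotient of a complex vector space \<open>U\<close> by a subspace \<open>W\<close> is handled through representatives:
  \<open>basis_mod scale U W bs\<close> says that the classes of the entries of the list \<open>bs\<close> form an (ordered)
  basis of \<open>U/W\<close>, and \<open>coords_mod scale W bs u\<close> is the coordinate vector of the class of \<open>u\<close>.
\<close>

definition lincomb_list ::
  "(complex \<Rightarrow> 'v \<Rightarrow> 'v::ab_group_add) \<Rightarrow> 'v list \<Rightarrow> complex vec \<Rightarrow> 'v" where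
  "lincomb_list scale bs a = (\<Sum>i<length bs. scale (a $ i) (bs ! i))"

definition basis_mod ::
  "(complex \<Rightarrow> 'v \<Rightarrow> 'v::ab_group_add) \<Rightarrow> 'v set \<Rightarrow> 'v set \<Rightarrow> 'v list \<Rightarrow> bool" where
  "basis_mod scale U W bs \<longleftrightarrow>
     set bs \<subseteq> U \<and>
     (\<forall>u\<in>U. \<exists>!a. a \<in> carrier_vec (length bs) \<and> u - lincomb_list scale bs a \<in> W)"

definition coords_mod ::
  "(complex \<Rightarrow> 'v \<Rightarrow> 'v::ab_group_add) \<Rightarrow> 'v set \<Rightarrow> 'v list \<Rightarrow> 'v \<Rightarrow> complex vec" where
  "coords_mod scale W bs u =
     (THE a. a \<in> carrier_vec (length bs) \<and> u - lincomb_list scale bs a \<in> W)"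

definition dim_mod ::
  "(complex \<Rightarrow> 'v \<Rightarrow> 'v::ab_group_add) \<Rightarrow> 'v set \<Rightarrow> 'v set \<Rightarrow> nat" where
  "dim_mod scale U W = (THE n. \<exists>bs. basis_mod scale U W bs \<and> length bs = n)"

abbreviation scale_poly :: "complex \<Rightarrow> 'r zw_poly \<Rightarrow> 'r zw_poly" where
  "scale_poly a f \<equiv> const_poly a * f"

abbreviation quotient_basis :: "'r zw_poly set \<Rightarrow> 'r zw_poly list \<Rightarrow> bool" where
  "quotient_basis I bs \<equiv> basis_mod scale_poly UNIV I bs"

text \<open>
  Zero dimensional: the quotient by the ideal is a nonzero finite-dimensional complex vector space.
\<close>

definition zero_dimensional :: "'r zw_poly set \<Rightarrow> bool" where
  "zero_dimensional I \<longleftrightarrow> I \<noteq> UNIV \<and> (\<exists>bs. quotient_basis I bs)"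

text \<open>
  The multiplicity of \<open>I\<close> at \<open>P\<close> is the complex dimension of \<open>\<O>\<^sub>P / I\<O>\<^sub>P\<close>, where \<open>\<O>\<^sub>P\<close> is the ring of
  rational functions that are defined at \<open>P\<close>.
\<close>

definition local_ring :: "'r::{finite,linorder} point \<Rightarrow> 'r zw_poly fract set" where
  "local_ring P = {Fraction_Field.Fract f g | f g. eval_zw P g \<noteq> 0}"

definition local_ideal ::
  "'r::{finite,linorder} zw_poly set \<Rightarrow> 'r point \<Rightarrow> 'r zw_poly fract set" where
  "local_ideal I P = {Fraction_Field.Fract f g | f g. f \<in> I \<and> eval_zw P g \<noteq> 0}"

definition multiplicity_at :: "'r::{finite,linorder} zw_poly set \<Rightarrow> 'r point \<Rightarrow> nat" where
  "multiplicity_at I P =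
     dim_mod (\<lambda>a q. Fraction_Field.Fract (const_poly a) 1 * q) (local_ring P) (local_ideal I P)"

text \<open>
  A linear endomorphism of the quotient by \<open>I\<close> is given by a linear map \<open>T\<close> on polynomials with
  \<open>T ` I \<subseteq> I\<close>.  Its trace does not depend on the basis, so any one will do.
\<close>

definition quotient_matrix ::
  "'r zw_poly set \<Rightarrow> 'r zw_poly list \<Rightarrow> ('r zw_poly \<Rightarrow> 'r zw_poly) \<Rightarrow> complex mat" where
  "quotient_matrix I bs T =
     mat (length bs) (length bs) (\<lambda>(i, j). coords_mod scale_poly I bs (T (bs ! j)) $ i)"

definition mat_trace :: "complex mat \<Rightarrow> complex" where
  "mat_trace A = (\<Sum>i<dim_row A. A $$ (i, i))"

definition quotient_trace :: "'r zw_poly set \<Rightarrow> ('r zw_poly \<Rightarrow> 'r zw_poly) \<Rightarrow> complex" where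
  "quotient_trace I T = mat_trace (quotient_matrix I (SOME bs. quotient_basis I bs) T)"

definition mult_map :: "'r zw_poly \<Rightarrow> 'r zw_poly \<Rightarrow> 'r zw_poly" where
  "mult_map g = (\<lambda>f. f * g)"

definition killing_form ::
  "'r zw_poly set \<Rightarrow> 'r zw_poly \<Rightarrow> 'r zw_poly \<Rightarrow> 'r zw_poly \<Rightarrow> complex" where
  "killing_form I \<xi> f g = quotient_trace I (mult_map \<xi> \<circ> mult_map f \<circ> mult_map (star g))"

text \<open>On \<^typ>\<open>complex\<close>, \<open>0 < x\<close> means that \<open>x\<close> is real and positive.\<close>

definition positive_definite_mod ::
  "'r zw_poly set \<Rightarrow> ('r zw_poly \<Rightarrow> 'r zw_poly \<Rightarrow> complex) \<Rightarrow> bool" where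
  "positive_definite_mod I B \<longleftrightarrow> (\<forall>f. f \<notin> I \<longrightarrow> 0 < B f f)"

definition form_matrix :: "'a list \<Rightarrow> ('a \<Rightarrow> 'a \<Rightarrow> complex) \<Rightarrow> complex mat" where
  "form_matrix bs B = mat (length bs) (length bs) (\<lambda>(i, j). B (bs ! i) (bs ! j))"

definition form_rank :: "'a list \<Rightarrow> ('a \<Rightarrow> 'a \<Rightarrow> complex) \<Rightarrow> nat" where
  "form_rank bs B = vec_space.rank (length bs) (form_matrix bs B)"

definition num_pos_eigenvalues :: "'a list \<Rightarrow> ('a \<Rightarrow> 'a \<Rightarrow> complex) \<Rightarrow> nat" where
  "num_pos_eigenvalues bs B = size {# x \<in># proots (char_poly (form_matrix bs B)). 0 < x #}"

definition num_neg_eigenvalues :: "'a list \<Rightarrow> ('a \<Rightarrow> 'a \<Rightarrow> complex) \<Rightarrow> nat" where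
  "num_neg_eigenvalues bs B = size {# x \<in># proots (char_poly (form_matrix bs B)). x < 0 #}"

definition signature_of_form :: "'a list \<Rightarrow> ('a \<Rightarrow> 'a \<Rightarrow> complex) \<Rightarrow> int" where
  "signature_of_form bs B = int (num_pos_eigenvalues bs B) - int (num_neg_eigenvalues bs B)"

end

theory Submission
  imports Defs "Jordan_Normal_Form.Schur_Decomposition"
begin

text \<open>
  Let \<open>V\<close> be the zero set of the ideal \<open>I\<close>, let \<open>A = \<complex>[z, w]/I\<close>, and for a point \<open>P = (z, w)\<close> let
  \<open>P\<^sup>* = (cnj w, cnj z)\<close> (\<open>conj_point\<close> below); the involution of the polynomial ring satisfies
  \<open>f\<^sup>*(P) = cnj (f(P\<^sup>*))\<close>, and \<open>P\<close> is a conjugated single exactly if \<open>P = P\<^sup>*\<close>.  Everything rests on the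
  formula \<open>Tr M\<^sub>f = (\<Sum>P\<in>V. m(P) f(P))\<close> with positive integers \<open>m(P) = m(P\<^sup>*)\<close>.  By Stickelberger's
  theorem the eigenvalues of \<open>M\<^sub>f\<close> on \<open>A\<close> are the values of \<open>f\<close> on \<open>V\<close>: one direction is the
  Nullstellensatz (an \<open>f\<close> without zeros on \<open>V\<close> is a unit of \<open>A\<close>), for the other the values of the basis
  elements at \<open>P\<close> form a left eigenvector.  So \<open>Tr M\<^sub>f\<close> vanishes if \<open>f\<close> vanishes on \<open>V\<close>, hence depends
  only on the values of \<open>f\<close> on \<open>V\<close>, and \<open>m(P)\<close> is the trace of a polynomial that is \<open>1\<close> at \<open>P\<close> and \<open>0\<close>
  at the other points: its only eigenvalues are \<open>0\<close> and \<open>1\<close>, and \<open>1\<close> occurs.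

  Consequently \<open>\<K>(f, g) = (\<Sum>P\<in>V. m(P) \<xi>(P) f(P) cnj (g(P\<^sup>*)))\<close>.  A conjugated single contributes the
  rank one form \<open>m(P) \<xi>(P) \<bar>f(P)\<bar>\<^sup>2\<close>, in which \<open>\<xi>(P)\<close> is real; a pair \<open>P \<noteq> P\<^sup>*\<close>, with
  \<open>a = m(P) \<xi>(P)\<close>, contributes \<open>2 Re (a f(P) cnj (f(P\<^sup>*)))\<close>, which is
  \<open>(\<bar>a f(P) + f(P\<^sup>*)\<bar>\<^sup>2 - \<bar>a f(P) - f(P\<^sup>*)\<bar>\<^sup>2) / 2\<close>, that is, one plus and one minus sign if
  \<open>a \<noteq> 0\<close> and nothing otherwise.  As evaluations at distinct points are linearly independent, this
  diagonalizes the form.  The rank is the number of nonzero coefficients.  The spectral theorem says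
  that the eigenvalues of the Hermitian matrix are the coefficients of another diagonalization, so by
  Sylvester's law of inertia the positive (negative) eigenvalues are as many as the conjugated singles
  with \<open>\<xi> > 0\<close> (\<open>\<xi> < 0\<close>) plus the pairs on which \<open>\<xi>\<close> is nonzero; the pairs cancel in the
  signature.  If \<open>\<xi>\<close> separates the points of \<open>V\<close>, then \<open>\<xi>\<close> is nonzero on every pair, because \<open>\<xi>(P\<^sup>*) = cnj (\<xi>(P))\<close>; so \<open>\<xi>\<close> sees as many
  pairs as the constant \<open>1\<close>, whose negative eigenvalues count exactly the pairs.

  Positive definiteness means that there are no pairs, that \<open>\<xi> > 0\<close> on \<open>V\<close>, and that a polynomial
  vanishing on \<open>V\<close> lies in \<open>I\<close>.  The last condition says that all multiplicities are \<open>1\<close>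
  (\<open>multiplicities_1_iff_radical\<close>): if the local algebra at every point is one-dimensional, a
  polynomial \<open>f\<close> vanishing on \<open>V\<close> satisfies, for every \<open>P\<close> in \<open>V\<close>, \<open>s f \<in> I\<close> for some \<open>s\<close> with
  \<open>s(P) \<noteq> 0\<close>, so the ideal of all \<open>s\<close> with \<open>s f \<in> I\<close> has no zeros and contains \<open>1\<close>.
\<close>

section \<open>Linear systems, traces and eigenvalues\<close>

text \<open>
  Padding the system with zero equations makes it square; its determinant vanishes, so it has a
  nonzero solution.
\<close>

lemma homogeneous_system_nontrivial:
  fixes a :: "'t \<Rightarrow> 'k \<Rightarrow> 'a::field"
  assumes K: "finite K" and T: "finite T" and less: "card T < card K"
  shows "\<exists>c. (\<exists>k\<in>K. c k \<noteq> 0) \<and> (\<forall>t\<in>T. (\<Sum>k\<in>K. c k * a t k) = 0)"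
proof -
  define n where "n = card K"
  obtain f where f: "bij_betw f {..<n} K"
    using K ex_bij_betw_nat_finite[of K] by (auto simp: n_def atLeast0LessThan)
  obtain g where g: "bij_betw g {..<card T} T"
    using T ex_bij_betw_nat_finite[of T] by (auto simp: atLeast0LessThan)
  define A where "A = mat n n (\<lambda>(i, j). if i < card T then a (g i) (f j) else 0)"
  have A: "A \<in> carrier_mat n n" by (simp add: A_def)
  have n: "n - 1 < n" "\<not> n - 1 < card T" using less by (auto simp: n_def)
  \<comment> \<open>The last row of \<open>A\<close> is zero, so the last unit vector is in the kernel of the transpose.\<close>
  have "transpose_mat A *\<^sub>v unit_vec n (n - 1) = 0\<^sub>v n"
    using n by (intro eq_vecI) (auto simp: A_def mult_mat_vec_def scalar_prod_right_unit)
  moreover have "unit_vec n (n - 1) \<noteq> (0\<^sub>v n :: 'a vec)"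
    using n(1) by (metis index_unit_vec(1) index_zero_vec(1) zero_neq_one)
  ultimately have "det (transpose_mat A) = 0"
    using A by (subst det_0_iff_vec_prod_zero_field[of _ n]) (auto intro!: exI[of _ "unit_vec n (n - 1)"])
  then have "det A = 0" using det_transpose[OF A] by simp
  then obtain v where v: "v \<in> carrier_vec n" "v \<noteq> 0\<^sub>v n" "A *\<^sub>v v = 0\<^sub>v n"
    using det_0_iff_vec_prod_zero_field[OF A] by blast
  define c where "c k = v $ (inv_into {..<n} f k)" for k
  have c: "c (f j) = v $ j" if "j < n" for j
    using f that by (simp add: c_def bij_betw_def inv_into_f_f)
  from v obtain j where j: "j < n" "v $ j \<noteq> 0"
    by (metis carrier_vecD eq_vecI index_zero_vec)
  have "f j \<in> K" using f j by (auto simp: bij_betw_def)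
  moreover have "(\<Sum>k\<in>K. c k * a t k) = 0" if "t \<in> T" for t
  proof -
    have "t \<in> g ` {..<card T}" using g that by (simp add: bij_betw_def)
    then obtain i where i: "i < card T" "g i = t" by auto
    with less have "i < n" by (simp add: n_def)
    have "(\<Sum>k\<in>K. c k * a t k) = (\<Sum>j<n. v $ j * a t (f j))"
      by (subst sum.reindex_bij_betw[OF f, symmetric]) (simp add: c)
    also have "\<dots> = (A *\<^sub>v v) $ i"
      using \<open>i < n\<close> i v(1) by (auto simp: A_def scalar_prod_def atLeast0LessThan mult.commute intro!: sum.cong)
    finally show ?thesis using v(3) \<open>i < n\<close> by simp
  qed
  ultimately show ?thesis using c[OF j(1)] j by (intro exI[of _ c]) (metis)
qed

lemma mat_trace_mult_commute:
  assumes "A \<in> carrier_mat n m" "B \<in> carrier_mat m n"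
  shows "mat_trace (A * B) = mat_trace (B * A)"
proof -
  have "mat_trace (A * B) = (\<Sum>i<n. \<Sum>k<m. A $$ (i, k) * B $$ (k, i))"
    using assms by (auto simp: mat_trace_def scalar_prod_def atLeast0LessThan intro!: sum.cong)
  also have "\<dots> = (\<Sum>k<m. \<Sum>i<n. B $$ (k, i) * A $$ (i, k))"
    by (subst sum.swap) (simp add: mult.commute)
  also have "\<dots> = mat_trace (B * A)"
    using assms by (auto simp: mat_trace_def scalar_prod_def atLeast0LessThan intro!: sum.cong)
  finally show ?thesis .
qed

lemma mat_trace_similar:
  assumes "similar_mat_wit A B P Q"
  shows "mat_trace A = mat_trace B"
proof -
  obtain n where n: "n = dim_row A" by simp
  note s = similar_mat_witD[OF n assms]
  have "mat_trace A = mat_trace (P * (B * Q))"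
    using s(3) assoc_mult_mat[OF s(6,5,7)] by simp
  also have "\<dots> = mat_trace (B * Q * P)"
    using s(5-7) by (intro mat_trace_mult_commute[of _ n n]) auto
  also have "B * Q * P = B"
    using s(2,5) assoc_mult_mat[OF s(5,7,6)] by simp
  finally show ?thesis .
qed

text \<open>
  Both traces can be read off the diagonal of a Schur form, which lists the eigenvalues.
\<close>

lemma mat_trace_eq_sum_eigenvalues:
  assumes A: "A \<in> carrier_mat n n" and es: "char_poly A = (\<Prod>e\<leftarrow>es. [:- e, 1:])"
  shows "mat_trace A = sum_list es" "mat_trace (A * A) = (\<Sum>e\<leftarrow>es. e\<^sup>2)"
proof -
  obtain B P Q where "schur_decomposition A es = (B, P, Q)" by (cases "schur_decomposition A es")
  from schur_decomposition[OF A es this] have sim: "similar_mat_wit A B P Q"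
    and ut: "upper_triangular B" and diag: "diag_mat B = es" by auto
  note s = similar_mat_witD2[OF A sim]
  have len: "length es = n" using diag s(5) by (auto simp: diag_mat_def)
  have nth: "B $$ (i, i) = es ! i" if "i < n" for i
    using diag that s(5) by (auto simp: diag_mat_def)
  show "mat_trace A = sum_list es"
    using s(5) nth len mat_trace_similar[OF sim]
    by (simp add: mat_trace_def sum_list_sum_nth atLeast0LessThan)
  have "A * A = P * (B * B) * Q"
  proof -
    have "A * A = P * B * Q * (P * B * Q)" using s(3) by simp
    also have "\<dots> = P * B * (Q * P) * B * Q"
      using s(5-7) by (simp add: assoc_mult_mat[of _ n n _ n _ n] mult_carrier_mat[of _ n n _ n])
    also have "\<dots> = P * (B * B) * Q"
      using s(2,5-7) by (simp add: assoc_mult_mat[of _ n n _ n _ n] mult_carrier_mat[of _ n n _ n])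
    finally show ?thesis .
  qed
  then have "similar_mat_wit (A * A) (B * B) P Q"
    using s by (intro similar_mat_witI[of _ _ n]) auto
  then have "mat_trace (A * A) = mat_trace (B * B)" by (rule mat_trace_similar)
  also have "\<dots> = (\<Sum>i<n. \<Sum>k<n. B $$ (i, k) * B $$ (k, i))"
    using s(5) by (auto simp: mat_trace_def scalar_prod_def atLeast0LessThan intro!: sum.cong)
  also have "\<dots> = (\<Sum>i<n. \<Sum>k<n. if k = i then (es ! i)\<^sup>2 else 0)"
  proof (intro sum.cong refl)
    fix i k assume ik: "i \<in> {..<n}" "k \<in> {..<n}"
    \<comment> \<open>Off the diagonal, one of the two factors lies strictly below the diagonal.\<close>
    have "B $$ (i, k) = 0 \<or> B $$ (k, i) = 0" if "k \<noteq> i"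
      using ut s(5) ik that unfolding upper_triangular_def by (metis carrier_matD(1) lessThan_iff nat_neq_iff)
    then show "B $$ (i, k) * B $$ (k, i) = (if k = i then (es ! i)\<^sup>2 else 0)"
      using ik nth by (auto simp: power2_eq_square)
  qed
  also have "\<dots> = (\<Sum>e\<leftarrow>es. e\<^sup>2)"
    by (simp add: sum_list_sum_nth atLeast0LessThan len)
  finally show "mat_trace (A * A) = (\<Sum>e\<leftarrow>es. e\<^sup>2)" .
qed

lemma eigenvalue_iff_in_linear_factors:
  fixes A :: "complex mat"
  assumes A: "A \<in> carrier_mat n n" and es: "char_poly A = (\<Prod>e\<leftarrow>es. [:- e, 1:])"
  shows "eigenvalue A x \<longleftrightarrow> x \<in> set es"
  by (simp add: eigenvalue_root_char_poly[OF A] es poly_prod_list prod_list_zero_iff image_iff)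

text \<open>
  For Hermitian \<open>A\<close> the trace of \<open>A\<^sup>2\<close> is the sum of the \<open>\<bar>a\<^sub>i\<^sub>k\<bar>\<^sup>2\<close>, and also the sum of the squares of
  the eigenvalues; so the eigenvalues cannot all be zero unless \<open>A\<close> is.
\<close>

lemma hermitian_nonzero_eigenvalue:
  assumes A: "A \<in> carrier_mat n n" 
    and herm: "\<And>i j. i < n \<Longrightarrow> j < n \<Longrightarrow> A $$ (j, i) = cnj (A $$ (i, j))"
    and "A \<noteq> 0\<^sub>m n n"
  shows "\<exists>\<mu>. \<mu> \<noteq> 0 \<and> eigenvalue A \<mu>"
proof (rule ccontr)
  assume no: "\<not> ?thesis"
  obtain es where es: "char_poly A = (\<Prod>e\<leftarrow>es. [:- e, 1:])"
    using char_poly_factorized[OF A] by blast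
  have "e = 0" if "e \<in> set es" for e
    using that no eigenvalue_iff_in_linear_factors[OF A es] by blast
  then have "map power2 es = map (\<lambda>_. 0) es" by simp
  then have "mat_trace (A * A) = 0"
    using mat_trace_eq_sum_eigenvalues(2)[OF A es] by (metis sum_list_0)
  moreover have "mat_trace (A * A) = (\<Sum>i<n. \<Sum>k<n. A $$ (i, k) * A $$ (k, i))"
    using A by (auto simp: mat_trace_def scalar_prod_def atLeast0LessThan intro!: sum.cong)
  moreover have "A $$ (i, k) * A $$ (k, i) = of_real ((cmod (A $$ (i, k)))\<^sup>2)" if "i < n" "k < n" for i k
    using herm[OF that] by (simp only: complex_norm_square)
  then have "(\<Sum>i<n. \<Sum>k<n. A $$ (i, k) * A $$ (k, i)) = (\<Sum>i<n. \<Sum>k<n. of_real ((cmod (A $$ (i, k)))\<^sup>2))"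
    by (intro sum.cong) auto
  ultimately have "(\<Sum>i<n. \<Sum>k<n. (cmod (A $$ (i, k)))\<^sup>2) = 0"
    by (simp only: of_real_sum[symmetric] of_real_eq_0_iff)
  then have "A $$ (i, k) = 0" if "i < n" "k < n" for i k
    using that by (simp add: sum_nonneg_eq_0_iff sum_nonneg)
  then have "A = 0\<^sub>m n n" using A by (intro eq_matI) auto
  with assms show False by simp
qed

section \<open>The spectral theorem for Hermitian matrices\<close>

text \<open>
  The number \<open>v\<^sup>* H v = \<mu> \<parallel>v\<parallel>\<^sup>2\<close> equals its own conjugate.
\<close>

lemma hermitian_eigenvalue_real:
  fixes H :: "nat \<Rightarrow> nat \<Rightarrow> complex"
  assumes herm: "\<And>i j. i < n \<Longrightarrow> j < n \<Longrightarrow> H j i = cnj (H i j)"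
    and eig: "\<And>i. i < n \<Longrightarrow> (\<Sum>j<n. H i j * v j) = \<mu> * v i"
    and nz: "\<exists>i<n. v i \<noteq> 0"
  shows "\<mu> \<in> \<real>"
proof -
  define s where "s = (\<Sum>i<n. (cmod (v i))\<^sup>2)"
  have "s > 0"
  proof -
    from nz obtain i where "i < n" "v i \<noteq> 0" by blast
    then have "0 < (cmod (v i))\<^sup>2" "(cmod (v i))\<^sup>2 \<le> s"
      unfolding s_def by (auto intro!: member_le_sum)
    then show ?thesis by linarith
  qed
  have q: "(\<Sum>i<n. \<Sum>j<n. cnj (v i) * H i j * v j) = \<mu> * of_real s"
  proof -
    have "(\<Sum>i<n. \<Sum>j<n. cnj (v i) * H i j * v j) = (\<Sum>i<n. cnj (v i) * (\<Sum>j<n. H i j * v j))"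
      by (simp add: sum_distrib_left mult.assoc)
    also have "\<dots> = (\<Sum>i<n. \<mu> * of_real ((cmod (v i))\<^sup>2))"
    proof (intro sum.cong refl)
      fix i assume "i \<in> {..<n}"
      then have "cnj (v i) * (\<Sum>j<n. H i j * v j) = cnj (v i) * (\<mu> * v i)" by (simp add: eig)
      then show "cnj (v i) * (\<Sum>j<n. H i j * v j) = \<mu> * of_real ((cmod (v i))\<^sup>2)"
        by (simp add: complex_norm_square mult_ac del: of_real_power)
    qed
    finally show ?thesis by (simp add: s_def sum_distrib_left)
  qed
  have "cnj (\<mu> * of_real s) = (\<Sum>i<n. \<Sum>j<n. cnj (v j) * cnj (H i j) * v i)"
    unfolding q[symmetric] by (simp add: mult_ac)
  also have "\<dots> = (\<Sum>i<n. \<Sum>j<n. cnj (v j) * H j i * v i)"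
    by (intro sum.cong refl arg_cong2[of _ _ _ _ "(*)"]) (auto intro: herm[symmetric])
  also have "\<dots> = \<mu> * of_real s"
    unfolding q[symmetric] by (rule sum.swap)
  finally have "cnj \<mu> = \<mu>" using \<open>s > 0\<close> by simp
  then show ?thesis by (metis Reals_cnj_iff)
qed

text \<open>
  Orthonormal eigenvectors are found one at a time.  After removing the spectral part already known,
  either the remaining matrix \<open>G\<close> is zero, and any vector orthogonal to the known eigenvectors is in
  the kernel of \<open>G\<close>, or \<open>G\<close> has an eigenvector for a nonzero eigenvalue, which is automatically
  orthogonal to the known eigenvectors because \<open>G\<close> kills them.
\<close>

lemma hermitian_orthonormal_eigenvectors:
  fixes H :: "nat \<Rightarrow> nat \<Rightarrow> complex"
  assumes herm: "\<And>i j. i < n \<Longrightarrow> j < n \<Longrightarrow> H j i = cnj (H i j)" and "m \<le> n"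
  shows "\<exists>u (ev::nat \<Rightarrow> real).
    (\<forall>j<m. \<forall>k<m. (\<Sum>i<n. u j i * cnj (u k i)) = (if j = k then 1 else 0)) \<and>
    (\<forall>k<m. \<forall>i<n. (\<Sum>j<n. H i j * u k j) = of_real (ev k) * u k i)"
  using \<open>m \<le> n\<close>
proof (induction m)
  case 0
  then show ?case by simp
next
  case (Suc m)
  then have "m \<le> n" by simp
  from Suc.IH[OF this] obtain u and ev :: "nat \<Rightarrow> real" where
    orth: "\<And>j k. j < m \<Longrightarrow> k < m \<Longrightarrow> (\<Sum>i<n. u j i * cnj (u k i)) = (if j = k then 1 else 0)"
    and eig: "\<And>k i. k < m \<Longrightarrow> i < n \<Longrightarrow> (\<Sum>j<n. H i j * u k j) = of_real (ev k) * u k i"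
    by blast
  \<comment> \<open>Removing the eigenvectors found so far leaves a matrix that kills them.\<close>
  define G where "G i j = H i j - (\<Sum>k<m. of_real (ev k) * u k i * cnj (u k j))" for i j
  have G_herm: "G j i = cnj (G i j)" if "i < n" "j < n" for i j
    unfolding G_def using herm[OF that] by (simp add: mult_ac)
  have G_kills: "(\<Sum>j<n. G i j * u k j) = 0" if "i < n" "k < m" for i k
  proof -
    have "(\<Sum>j<n. G i j * u k j) = (\<Sum>j<n. H i j * u k j)
        - (\<Sum>j<n. \<Sum>l<m. of_real (ev l) * u l i * (u k j * cnj (u l j)))"
      by (simp add: G_def algebra_simps sum_subtractf sum_distrib_left)
    also have "(\<Sum>j<n. \<Sum>l<m. of_real (ev l) * u l i * (u k j * cnj (u l j)))
       = (\<Sum>l<m. of_real (ev l) * u l i * (\<Sum>j<n. u k j * cnj (u l j)))"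
      by (subst sum.swap) (simp add: sum_distrib_left)
    also have "\<dots> = (\<Sum>l<m. if k = l then of_real (ev l) * u l i else 0)"
      using orth that by (intro sum.cong refl) auto
    finally show ?thesis using eig that by simp
  qed
  have G_on_complement: "(\<Sum>j<n. G i j * v j) = (\<Sum>j<n. H i j * v j)"
    if "\<And>k. k < m \<Longrightarrow> (\<Sum>i<n. v i * cnj (u k i)) = 0" for v i
  proof -
    have "(\<Sum>j<n. G i j * v j) = (\<Sum>j<n. H i j * v j)
        - (\<Sum>j<n. \<Sum>l<m. of_real (ev l) * u l i * (v j * cnj (u l j)))"
      by (simp add: G_def algebra_simps sum_subtractf sum_distrib_left)
    also have "(\<Sum>j<n. \<Sum>l<m. of_real (ev l) * u l i * (v j * cnj (u l j)))
       = (\<Sum>l<m. of_real (ev l) * u l i * (\<Sum>j<n. v j * cnj (u l j)))"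
      by (subst sum.swap) (simp add: sum_distrib_left)
    finally show ?thesis using that by simp
  qed
  obtain v \<mu> where v: "\<exists>i<n. v i \<noteq> 0"
    and v_orth: "\<And>k. k < m \<Longrightarrow> (\<Sum>i<n. v i * cnj (u k i)) = 0"
    and v_eig: "\<And>i. i < n \<Longrightarrow> (\<Sum>j<n. H i j * v j) = \<mu> * v i"
  proof (cases "\<forall>i<n. \<forall>j<n. G i j = 0")
    case True
    obtain v where v: "\<exists>i<n. v i \<noteq> 0" "\<And>k. k < m \<Longrightarrow> (\<Sum>i<n. v i * cnj (u k i)) = 0"
      using homogeneous_system_nontrivial[of "{..<n}" "{..<m}" "\<lambda>k i. cnj (u k i)"] Suc.prems by auto
    have "(\<Sum>j<n. H i j * v j) = 0 * v i" if "i < n" for i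
      using G_on_complement[OF v(2), of i] True that by simp
    with v show ?thesis by (intro that[of v 0])
  next
    case False
    define A where "A = mat n n (\<lambda>(i, j). G i j)"
    have A: "A \<in> carrier_mat n n" by (simp add: A_def)
    have "A $$ (j, i) = cnj (A $$ (i, j))" if "i < n" "j < n" for i j
      using G_herm[OF that] that by (simp add: A_def)
    moreover have "A \<noteq> 0\<^sub>m n n"
      using False by (auto simp: A_def mat_eq_iff)
    ultimately obtain \<mu> where \<mu>: "\<mu> \<noteq> 0" "eigenvalue A \<mu>"
      using hermitian_nonzero_eigenvalue[OF A] by blast
    then obtain w where w: "w \<in> carrier_vec n" "w \<noteq> 0\<^sub>v n" "A *\<^sub>v w = \<mu> \<cdot>\<^sub>v w"
      using A by (auto simp: eigenvalue_def eigenvector_def)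
    define v where "v i = w $ i" for i
    have nz: "\<exists>i<n. v i \<noteq> 0"
      using w by (metis carrier_vecD eq_vecI index_zero_vec v_def)
    have Gv: "(\<Sum>j<n. G i j * v j) = \<mu> * v i" if "i < n" for i
    proof -
      have "(\<Sum>j<n. G i j * v j) = (A *\<^sub>v w) $ i"
        using that w(1) by (auto simp: A_def v_def scalar_prod_def atLeast0LessThan intro!: sum.cong)
      also have "\<dots> = \<mu> * v i" using that w by (simp add: v_def)
      finally show ?thesis .
    qed
    have orth_v: "(\<Sum>i<n. v i * cnj (u k i)) = 0" if "k < m" for k
    proof -
      have "\<mu> * (\<Sum>i<n. v i * cnj (u k i)) = (\<Sum>i<n. (\<Sum>j<n. G i j * v j) * cnj (u k i))"
        by (simp add: Gv sum_distrib_left mult.assoc)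
      also have "\<dots> = (\<Sum>j<n. v j * (\<Sum>i<n. G i j * cnj (u k i)))"
        unfolding sum_distrib_left sum_distrib_right
        by (subst sum.swap) (simp add: mult_ac)
      also have "\<dots> = (\<Sum>j<n. v j * cnj (\<Sum>i<n. G j i * u k i))"
      proof (intro sum.cong refl arg_cong2[of _ _ _ _ "(*)"])
        fix j assume j: "j \<in> {..<n}"
        have "G i j = cnj (G j i)" if "i < n" for i
          using G_herm[of j i] j that by simp
        then show "(\<Sum>i<n. G i j * cnj (u k i)) = cnj (\<Sum>i<n. G j i * u k i)" by simp
      qed
      also have "\<dots> = 0" using G_kills that by simp
      finally show ?thesis using \<mu> by simp
    qed
    show ?thesis
      using nz orth_v Gv G_on_complement[OF orth_v] by (intro that[of v \<mu>]) auto
  qed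
  have "\<mu> \<in> \<real>" using hermitian_eigenvalue_real[OF herm v_eig v] by blast
  then obtain r where r: "\<mu> = of_real r" by (auto elim: Reals_cases)
  define s where "s = (\<Sum>i<n. (cmod (v i))\<^sup>2)"
  have "s > 0"
  proof -
    from v obtain i where "i < n" "v i \<noteq> 0" by blast
    then have "0 < (cmod (v i))\<^sup>2" "(cmod (v i))\<^sup>2 \<le> s"
      unfolding s_def by (auto intro!: member_le_sum)
    then show ?thesis by linarith
  qed
  define t where "t = (of_real (1 / sqrt s) :: complex)"
  have t: "t * cnj t * of_real s = 1" 
  proof -
    have "t * cnj t * of_real s = of_real (1 / sqrt s * (1 / sqrt s) * s)"
      unfolding t_def by (simp only: complex_cnj_complex_of_real of_real_mult)
    also have "1 / sqrt s * (1 / sqrt s) * s = 1"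
      using \<open>s > 0\<close> by (simp add: field_simps)
    finally show ?thesis by simp
  qed
  \<comment> \<open>The new eigenvector is \<open>v\<close>, scaled by \<open>t\<close> to length one.\<close>
  define u' where "u' = u(m := (\<lambda>i. t * v i))"
  have u'_less: "u' k = u k" if "k < m" for k using that by (simp add: u'_def)
  have u'_m: "u' m = (\<lambda>i. t * v i)" by (simp add: u'_def)
  have right: "(\<Sum>i<n. u' m i * cnj (u k i)) = 0" if "k < m" for k
    using v_orth[OF that] by (simp add: u'_m mult.assoc flip: sum_distrib_left)
  have left: "(\<Sum>i<n. u k i * cnj (u' m i)) = 0" if "k < m" for k
  proof -
    have "(\<Sum>i<n. u k i * cnj (u' m i)) = cnj (\<Sum>i<n. u' m i * cnj (u k i))"
      by (simp add: mult_ac)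
    then show ?thesis using right[OF that] by simp
  qed
  have norm: "(\<Sum>i<n. u' m i * cnj (u' m i)) = 1"
  proof -
    have "(\<Sum>i<n. u' m i * cnj (u' m i)) = t * cnj t * (\<Sum>i<n. v i * cnj (v i))"
      by (simp add: u'_m sum_distrib_left mult_ac)
    also have "(\<Sum>i<n. v i * cnj (v i)) = of_real s"
      by (simp add: s_def complex_norm_square del: of_real_power)
    finally show ?thesis using t by simp
  qed
  show ?case
  proof (intro exI[of _ u'] exI[of _ "ev(m := r)"] conjI allI impI)
    fix j k assume "j < Suc m" "k < Suc m"
    then consider "j < m" "k < m" | "j = m" "k = m" | "j = m" "k < m" | "j < m" "k = m" by linarith
    then show "(\<Sum>i<n. u' j i * cnj (u' k i)) = (if j = k then 1 else 0)"
    proof cases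
      case 1 then show ?thesis by (simp only: u'_less orth)
    next
      case 2 then show ?thesis by (simp only: norm refl if_True)
    next
      case 3 then show ?thesis by (simp add: u'_less right)
    next
      case 4 then show ?thesis by (simp add: u'_less left)
    qed
  next
    fix k i assume ki: "k < Suc m" "i < n"
    show "(\<Sum>j<n. H i j * u' k j) = of_real ((ev(m := r)) k) * u' k i"
    proof (cases "k = m")
      case True
      have "(\<Sum>j<n. H i j * (t * v j)) = t * (\<Sum>j<n. H i j * v j)"
        by (simp add: sum_distrib_left mult.left_commute)
      also have "\<dots> = of_real r * (t * v i)"
        unfolding v_eig[OF ki(2)] r by simp
      finally show ?thesis unfolding True u'_m by simp
    next
      case False
      then have "k < m" using ki by simp
      then show ?thesis using eig[OF _ ki(2)] by (simp add: u'_less)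
    qed
  qed
qed

section \<open>Sylvester's law of inertia\<close>

text \<open>
  The Hermitian form \<open>H\<close> is written as \<open>\<Sum>k\<in>K. d\<^sub>k \<bar>l\<^sub>k\<bar>\<^sup>2\<close> with linear functionals \<open>l\<^sub>k\<close>.  Their linear
  independence is expressed by the family \<open>v\<close> of vectors dual to them.  The index set is arbitrary, so
  that it can consist of numbers as well as of points, and the number of functionals may be smaller
  than the dimension.
\<close>

definition hermitian_diagonalization ::
  "nat \<Rightarrow> (nat \<Rightarrow> nat \<Rightarrow> complex) \<Rightarrow> 'k set \<Rightarrow> ('k \<Rightarrow> real) \<Rightarrow> ('k \<Rightarrow> nat \<Rightarrow> complex) \<Rightarrow> ('k \<Rightarrow> nat \<Rightarrow> complex) \<Rightarrow> bool"
where
  "hermitian_diagonalization n H K d l v \<longleftrightarrow>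
     finite K \<and>
     (\<forall>i<n. \<forall>j<n. H i j = (\<Sum>k\<in>K. of_real (d k) * l k i * cnj (l k j))) \<and>
     (\<forall>k\<in>K. \<forall>k'\<in>K. (\<Sum>i<n. l k i * v k' i) = (if k = k' then 1 else 0))"

lemma hermitian_diagonalization_form:
  assumes "hermitian_diagonalization n H K d l v"
  shows "(\<Sum>i<n. \<Sum>j<n. x i * cnj (x j) * H i j)
       = of_real (\<Sum>k\<in>K. d k * (cmod (\<Sum>i<n. l k i * x i))\<^sup>2)"
proof -
  have "(\<Sum>i<n. \<Sum>j<n. x i * cnj (x j) * H i j)
      = (\<Sum>i<n. \<Sum>j<n. \<Sum>k\<in>K. of_real (d k) * (l k i * x i) * cnj (l k j * x j))"
    using assms by (intro sum.cong refl) (simp add: hermitian_diagonalization_def sum_distrib_left mult_ac)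
  also have "\<dots> = (\<Sum>k\<in>K. \<Sum>i<n. \<Sum>j<n. of_real (d k) * (l k i * x i) * cnj (l k j * x j))"
    by (subst sum.swap[of _ "{..<n}" K], intro sum.cong refl, rule sum.swap)
  also have "\<dots> = (\<Sum>k\<in>K. of_real (d k) * ((\<Sum>i<n. l k i * x i) * cnj (\<Sum>j<n. l k j * x j)))"
    by (simp add: sum_distrib_left sum_distrib_right mult.assoc)
       (intro sum.cong refl sum.swap)
  also have "\<dots> = of_real (\<Sum>k\<in>K. d k * (cmod (\<Sum>i<n. l k i * x i))\<^sup>2)"
    by (simp add: complex_norm_square del: of_real_power)
  finally show ?thesis .
qed

text \<open>
  If there were fewer positive \<open>d'\<^sub>k\<close> than positive \<open>d\<^sub>k\<close>, some nonzero combination \<open>x\<close> of the \<open>v\<^sub>k\<close> with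
  \<open>d\<^sub>k > 0\<close> would be annihilated by all \<open>l'\<^sub>k\<close> with \<open>d'\<^sub>k > 0\<close>.  The form would be positive at \<open>x\<close> by the
  first decomposition, and at most zero by the second.
\<close>

lemma positive_index_le:
  assumes D: "hermitian_diagonalization n H K d l v"
    and D': "hermitian_diagonalization n H K' d' l' v'"
  shows "card {k\<in>K. 0 < d k} \<le> card {k\<in>K'. 0 < d' k}"
proof (rule ccontr)
  define P where "P = {k\<in>K. 0 < d k}"
  define P' where "P' = {k\<in>K'. 0 < d' k}"
  have fin: "finite K" "finite K'" "finite P" "finite P'"
    using D D' by (auto simp: P_def P'_def hermitian_diagonalization_def)
  assume "\<not> card {k\<in>K. 0 < d k} \<le> card {k\<in>K'. 0 < d' k}"
  then have "card P' < card P" by (simp add: P_def P'_def)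
  from homogeneous_system_nontrivial[OF fin(3,4) this, of "\<lambda>t k. \<Sum>i<n. l' t i * v k i"]
  obtain c where c: "\<exists>k\<in>P. c k \<noteq> 0"
    and c0: "\<And>t. t \<in> P' \<Longrightarrow> (\<Sum>k\<in>P. c k * (\<Sum>i<n. l' t i * v k i)) = 0" by blast
  \<comment> \<open>The vector at which the two decompositions disagree on the sign of the form.\<close>
  define x where "x i = (\<Sum>k\<in>P. c k * v k i)" for i
  have lx: "(\<Sum>i<n. f i * x i) = (\<Sum>k\<in>P. c k * (\<Sum>i<n. f i * v k i))" for f
    unfolding x_def sum_distrib_left by (subst sum.swap) (simp add: mult_ac)
  have l_x: "(\<Sum>i<n. l k i * x i) = (if k \<in> P then c k else 0)" if "k \<in> K" for k
  proof -
    have "(\<Sum>i<n. l k i * x i) = (\<Sum>k'\<in>P. if k = k' then c k' else 0)"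
      unfolding lx using D that
      by (intro sum.cong refl) (auto simp: P_def hermitian_diagonalization_def)
    then show ?thesis using fin by simp
  qed
  have "0 < (\<Sum>k\<in>P. d k * (cmod (c k))\<^sup>2)"
  proof -
    from c obtain k where "k \<in> P" "c k \<noteq> 0" by blast
    then show ?thesis
      using fin by (intro sum_pos2[of _ k]) (auto simp: P_def)
  qed
  also have "\<dots> = (\<Sum>k\<in>K. d k * (cmod (\<Sum>i<n. l k i * x i))\<^sup>2)"
    using fin by (intro sum.mono_neutral_cong_left) (auto simp: P_def l_x)
  also have "\<dots> = (\<Sum>k\<in>K'. d' k * (cmod (\<Sum>i<n. l' k i * x i))\<^sup>2)"
    using hermitian_diagonalization_form[OF D, of x] hermitian_diagonalization_form[OF D', of x]
    by (simp only: of_real_eq_iff)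
  also have "\<dots> \<le> 0"
  proof (intro sum_nonpos)
    fix k assume "k \<in> K'"
    show "d' k * (cmod (\<Sum>i<n. l' k i * x i))\<^sup>2 \<le> 0"
    proof (cases "k \<in> P'")
      case True
      then show ?thesis unfolding lx using c0 by simp
    next
      case False
      then show ?thesis using \<open>k \<in> K'\<close> by (simp add: P'_def mult_nonpos_nonneg)
    qed
  qed
  finally show False by simp
qed

lemma hermitian_diagonalization_uminus:
  assumes "hermitian_diagonalization n H K d l v"
  shows "hermitian_diagonalization n (\<lambda>i j. - H i j) K (\<lambda>k. - d k) l v"
  using assms by (simp add: hermitian_diagonalization_def sum_negf)

theorem sylvester_law_of_inertia:
  assumes D: "hermitian_diagonalization n H K d l v"
    and D': "hermitian_diagonalization n H K' d' l' v'"
  shows "card {k\<in>K. 0 < d k} = card {k\<in>K'. 0 < d' k}"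
    and "card {k\<in>K. d k < 0} = card {k\<in>K'. d' k < 0}"
  using positive_index_le[OF D D'] positive_index_le[OF D' D]
    positive_index_le[OF hermitian_diagonalization_uminus[OF D] hermitian_diagonalization_uminus[OF D']]
    positive_index_le[OF hermitian_diagonalization_uminus[OF D'] hermitian_diagonalization_uminus[OF D]]
  by simp_all

text \<open>
  The eigenvalues of a Hermitian matrix are the coefficients of one particular diagonalization, given
  by an orthonormal basis of eigenvectors.
\<close>

theorem spectral_diagonalization:
  fixes H :: "nat \<Rightarrow> nat \<Rightarrow> complex"
  assumes herm: "\<And>i j. i < n \<Longrightarrow> j < n \<Longrightarrow> H j i = cnj (H i j)"
  shows "\<exists>ev l v. hermitian_diagonalization n H {..<n} ev l v \<and>
    char_poly (mat n n (\<lambda>(i, j). H i j)) = (\<Prod>k<n. [:- of_real (ev k), 1:])"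
proof -
  obtain u and ev :: "nat \<Rightarrow> real" where
    orth: "\<And>j k. j < n \<Longrightarrow> k < n \<Longrightarrow> (\<Sum>i<n. u j i * cnj (u k i)) = (if j = k then 1 else 0)"
    and eig: "\<And>k i. k < n \<Longrightarrow> i < n \<Longrightarrow> (\<Sum>j<n. H i j * u k j) = of_real (ev k) * u k i"
    using hermitian_orthonormal_eigenvectors[of n H n, OF herm order_refl] by blast
  define A where "A = mat n n (\<lambda>(i, j). H i j)"
  define U where "U = mat n n (\<lambda>(i, k). u k i)"
  define U' where "U' = mat n n (\<lambda>(k, i). cnj (u k i))"
  define L where "L = mat n n (\<lambda>(i, k). if i = k then complex_of_real (ev k) else 0)"
  have car: "A \<in> carrier_mat n n" "U \<in> carrier_mat n n" "U' \<in> carrier_mat n n" "L \<in> carrier_mat n n"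
    by (simp_all add: A_def U_def U'_def L_def)
  have U'U: "U' * U = 1\<^sub>m n"
  proof (rule eq_matI)
    fix j k assume jk: "j < dim_row (1\<^sub>m n)" "k < dim_col (1\<^sub>m n)"
    then have "(U' * U) $$ (j, k) = (\<Sum>i<n. u k i * cnj (u j i))"
      by (simp add: U_def U'_def scalar_prod_def atLeast0LessThan mult.commute)
    then show "(U' * U) $$ (j, k) = 1\<^sub>m n $$ (j, k)" using jk orth by simp
  qed (simp_all add: U_def U'_def)
  then have UU': "U * U' = 1\<^sub>m n"
    using mat_mult_left_right_inverse car by blast
  have AU: "A * U = U * L"
  proof (rule eq_matI)
    fix i k assume "i < dim_row (U * L)" "k < dim_col (U * L)"
    then have ik: "i < n" "k < n" by (simp_all add: U_def L_def)
    have "(A * U) $$ (i, k) = (\<Sum>j<n. H i j * u k j)"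
      using ik by (simp add: A_def U_def scalar_prod_def atLeast0LessThan)
    also have "\<dots> = (\<Sum>j<n. u j i * (if j = k then of_real (ev k) else 0))"
      using ik eig by (simp add: if_distrib mult.commute cong: if_cong)
    also have "\<dots> = (U * L) $$ (i, k)"
      using ik by (auto simp: U_def L_def scalar_prod_def atLeast0LessThan intro!: sum.cong)
    finally show "(A * U) $$ (i, k) = (U * L) $$ (i, k)" .
  qed (simp_all add: A_def U_def L_def)
  have A_eq: "A = U * L * U'"
  proof -
    have "A = A * (U * U')" using car by (simp add: UU')
    also have "\<dots> = A * U * U'" using assoc_mult_mat[OF car(1,2,3)] by simp
    finally show ?thesis by (simp add: AU)
  qed
  have "similar_mat A L"
    unfolding similar_mat_def
    using similar_mat_witI[OF UU' U'U A_eq car(1,4,2,3)] by blast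
  then have "char_poly A = char_poly L" by (rule char_poly_similar)
  also have "\<dots> = (\<Prod>a\<leftarrow>diag_mat L. [:- a, 1:])"
    by (intro char_poly_upper_triangular[OF car(4)]) (auto simp: L_def upper_triangular_def)
  also have "diag_mat L = map (\<lambda>k. of_real (ev k)) [0..<n]"
    by (auto simp: diag_mat_def L_def)
  also have "(\<Prod>a\<leftarrow>map (\<lambda>k. of_real (ev k)) [0..<n]. [:- a, 1:]) = (\<Prod>k<n. [:- complex_of_real (ev k), 1:])"
    by (induction n) (simp_all add: mult.commute)
  finally have cp: "char_poly A = (\<Prod>k<n. [:- complex_of_real (ev k), 1:])" .
  have "H i j = (\<Sum>k<n. of_real (ev k) * u k i * cnj (u k j))" if ij: "i < n" "j < n" for i j
  proof -
    have "H i j = (A * U * U') $$ (i, j)" unfolding AU A_eq[symmetric] using ij by (simp add: A_def)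
    also have "\<dots> = (\<Sum>k<n. (A * U) $$ (i, k) * U' $$ (k, j))"
    proof -
      obtain X where X: "X = A * U" by simp
      then have "X \<in> carrier_mat n n" using car by simp
      then show ?thesis using ij car by (simp add: scalar_prod_def atLeast0LessThan flip: X)
    qed
    also have "\<dots> = (\<Sum>k<n. of_real (ev k) * u k i * cnj (u k j))"
    proof (intro sum.cong refl)
      fix k assume "k \<in> {..<n}"
      then have "(A * U) $$ (i, k) = (\<Sum>j<n. H i j * u k j)"
        using ij by (simp add: A_def U_def scalar_prod_def atLeast0LessThan)
      then show "(A * U) $$ (i, k) * U' $$ (k, j) = of_real (ev k) * u k i * cnj (u k j)"
        using eig ij \<open>k \<in> {..<n}\<close> by (simp add: U'_def)
    qed
    finally show ?thesis .
  qed
  then have "hermitian_diagonalization n H {..<n} ev u (\<lambda>k i. cnj (u k i))"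
    unfolding hermitian_diagonalization_def using orth by simp
  with cp show ?thesis unfolding A_def by blast
qed

text \<open>
  The matrix factors as \<open>B C\<close> with \<open>B\<close> injective and \<open>C\<close> surjective, since the dual families provide a
  left inverse of \<open>B\<close> and a right inverse of \<open>C\<close>.  So its column space is that of \<open>B\<close>, whose columns
  are independent.
\<close>

lemma rank_eq_card_if_dual_families:
  fixes \<beta> \<gamma> :: "'k \<Rightarrow> nat \<Rightarrow> complex"
  assumes K: "finite K"
    and H: "\<And>i j. i < n \<Longrightarrow> j < n \<Longrightarrow> H i j = (\<Sum>k\<in>K. \<beta> k i * \<gamma> k j)"
    and \<beta>: "\<And>k k'. k \<in> K \<Longrightarrow> k' \<in> K \<Longrightarrow> (\<Sum>i<n. \<beta> k i * \<beta>' k' i) = (if k = k' then 1 else 0)"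
    and \<gamma>: "\<And>k k'. k \<in> K \<Longrightarrow> k' \<in> K \<Longrightarrow> (\<Sum>i<n. \<gamma> k i * \<gamma>' k' i) = (if k = k' then 1 else 0)"
  shows "vec_space.rank n (mat n n (\<lambda>(i, j). H i j)) = card K"
proof -
  interpret vec_space "TYPE(complex)" n .
  define r where "r = card K"
  obtain f where f: "bij_betw f {..<r} K"
    using K ex_bij_betw_nat_finite[of K] by (auto simp: r_def atLeast0LessThan)
  have fK: "f k \<in> K" if "k < r" for k using f that by (auto simp: bij_betw_def)
  have f_eq: "f k = f k' \<longleftrightarrow> k = k'" if "k < r" "k' < r" for k k'
    using f that by (auto simp: bij_betw_def inj_on_def)
  define A where "A = mat n n (\<lambda>(i, j). H i j)"
  define B where "B = mat n r (\<lambda>(i, k). \<beta> (f k) i)"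
  define B' where "B' = mat r n (\<lambda>(k, i). \<beta>' (f k) i)"
  define C where "C = mat r n (\<lambda>(k, j). \<gamma> (f k) j)"
  define C' where "C' = mat n r (\<lambda>(j, k). \<gamma>' (f k) j)"
  have car: "A \<in> carrier_mat n n" "B \<in> carrier_mat n r" "B' \<in> carrier_mat r n"
    "C \<in> carrier_mat r n" "C' \<in> carrier_mat n r"
    by (simp_all add: A_def B_def B'_def C_def C'_def)
  have A: "A = B * C"
  proof (rule eq_matI)
    fix i j assume "i < dim_row (B * C)" "j < dim_col (B * C)"
    then have ij: "i < n" "j < n" by (simp_all add: B_def C_def)
    have "A $$ (i, j) = (\<Sum>k<r. \<beta> (f k) i * \<gamma> (f k) j)"
      using ij H by (simp add: A_def sum.reindex_bij_betw[OF f, of "\<lambda>k. \<beta> k i * \<gamma> k j"])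
    then show "A $$ (i, j) = (B * C) $$ (i, j)"
      using ij by (simp add: B_def C_def scalar_prod_def atLeast0LessThan)
  qed (simp_all add: A_def B_def C_def)
  have B'B: "B' * B = 1\<^sub>m r"
    by (rule eq_matI)
       (auto simp: B_def B'_def scalar_prod_def atLeast0LessThan mult.commute \<beta> fK f_eq)
  have CC': "C * C' = 1\<^sub>m r"
    by (rule eq_matI)
       (auto simp: C_def C'_def scalar_prod_def atLeast0LessThan \<gamma> fK f_eq)
  have AC': "A * C' = B"
    unfolding A using assoc_mult_mat[OF car(2,4,5)] car by (simp add: CC')
  have B_inj: "w = w'" if "w \<in> carrier_vec r" "w' \<in> carrier_vec r" "B *\<^sub>v w = B *\<^sub>v w'" for w w'
  proof -
    have "B' * B *\<^sub>v w = B' * B *\<^sub>v w'" using that car by simp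
    then show ?thesis using that by (simp add: B'B)
  qed
  have "col_space A = col_space B"
  proof -
    have "\<exists>y\<in>carrier_vec r. B *\<^sub>v y = A *\<^sub>v x" if "x \<in> carrier_vec n" for x
      using that car by (intro bexI[of _ "C *\<^sub>v x"]) (auto simp: A)
    moreover have "\<exists>y\<in>carrier_vec n. A *\<^sub>v y = B *\<^sub>v x" if "x \<in> carrier_vec r" for x
      using that car assoc_mult_mat_vec[OF car(1,5) that]
      by (intro bexI[of _ "C' *\<^sub>v x"]) (auto simp: AC')
    ultimately show ?thesis
      unfolding col_space_eq[OF car(1)] col_space_eq[OF car(2)] using car by (auto; metis)
  qed
  then have "rank A = rank B" by (simp add: rank_def col_space_def)
  also have "\<dots> = r"
  proof (rule lin_indpt_full_rank[OF car(2)])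
    show dist: "distinct (cols B)"
    proof (unfold distinct_conv_nth, intro allI impI)
      fix k k' assume k: "k < length (cols B)" "k' < length (cols B)" "k \<noteq> k'"
      then have k': "k < r" "k' < r" by (simp_all add: B_def)
      show "cols B ! k \<noteq> cols B ! k'"
      proof
        assume "cols B ! k = cols B ! k'"
        then have "B *\<^sub>v unit_vec r k = B *\<^sub>v unit_vec r k'"
          using k' car by (simp add: B_def mult_mat_vec_def col_def scalar_prod_right_unit vec_eq_iff)
        then have "unit_vec r k = (unit_vec r k' :: complex vec)" 
          by (rule B_inj[OF unit_vec_carrier unit_vec_carrier])
        with k k' show False by (metis index_unit_vec(1) zero_neq_one)
      qed
    qed
    show "lin_indpt (set (cols B))"
    proof
      assume "lin_dep (set (cols B))"
      from lin_depE[OF car(2) this dist] obtain w where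
        w: "w \<in> carrier_vec r" "w \<noteq> 0\<^sub>v r" "B *\<^sub>v w = 0\<^sub>v n" .
      have "w = 0\<^sub>v r" by (rule B_inj) (use w car in auto)
      with w show False by simp
    qed
  qed
  finally show ?thesis by (simp add: A_def r_def)
qed

text \<open>
  By Sylvester's law, any diagonalization has as many positive and negative coefficients as the one by
  eigenvectors.
\<close>

theorem inertia_of_diagonalization:
  assumes D: "hermitian_diagonalization n H K d l v"
  defines "A \<equiv> mat n n (\<lambda>(i, j). H i j)"
  shows "vec_space.rank n A = card {k\<in>K. d k \<noteq> 0}"
    and "size {# x \<in># proots (char_poly A). 0 < x #} = card {k\<in>K. 0 < d k}"
    and "size {# x \<in># proots (char_poly A). x < 0 #} = card {k\<in>K. d k < 0}"
proof -
  have fin: "finite K" using D by (simp add: hermitian_diagonalization_def)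
  have H: "H i j = (\<Sum>k\<in>K. of_real (d k) * l k i * cnj (l k j))" if "i < n" "j < n" for i j
    using D that by (simp add: hermitian_diagonalization_def)
  have dual: "(\<Sum>i<n. l k i * v k' i) = (if k = k' then 1 else 0)" if "k \<in> K" "k' \<in> K" for k k'
    using D that by (simp add: hermitian_diagonalization_def)
  show "vec_space.rank n A = card {k\<in>K. d k \<noteq> 0}"
    unfolding A_def
  proof (rule rank_eq_card_if_dual_families)
    show "finite {k\<in>K. d k \<noteq> 0}" using fin by simp
    show "H i j = (\<Sum>k\<in>{k\<in>K. d k \<noteq> 0}. (of_real (d k) * l k i) * cnj (l k j))" if "i < n" "j < n" for i j
      unfolding H[OF that] using fin by (intro sum.mono_neutral_right) auto
    show "(\<Sum>i<n. of_real (d k) * l k i * (v k' i / of_real (d k'))) = (if k = k' then 1 else 0)"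
      if "k \<in> {k\<in>K. d k \<noteq> 0}" "k' \<in> {k\<in>K. d k \<noteq> 0}" for k k'
    proof -
      have "(\<Sum>i<n. of_real (d k) * l k i * (v k' i / of_real (d k'))) = of_real (d k) / of_real (d k') * (\<Sum>i<n. l k i * v k' i)"
        by (simp add: sum_distrib_left mult.assoc)
      then show ?thesis using dual that by simp
    qed
    show "(\<Sum>i<n. cnj (l k i) * cnj (v k' i)) = (if k = k' then 1 else 0)"
      if "k \<in> {k\<in>K. d k \<noteq> 0}" "k' \<in> {k\<in>K. d k \<noteq> 0}" for k k'
    proof -
      have "(\<Sum>i<n. cnj (l k i) * cnj (v k' i)) = cnj (\<Sum>i<n. l k i * v k' i)" by simp
      also have "\<dots> = (if k = k' then 1 else 0)" by (subst dual) (use that in auto)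
      finally show ?thesis .
    qed
  qed
  have herm: "H j i = cnj (H i j)" if "i < n" "j < n" for i j
    unfolding H[OF that] H[OF that(2,1)] cnj_sum by (intro sum.cong refl) (simp add: mult_ac)
  obtain ev l' v' where D': "hermitian_diagonalization n H {..<n} ev l' v'"
    and cp: "char_poly A = (\<Prod>k<n. [:- complex_of_real (ev k), 1:])"
    using spectral_diagonalization[of n H, OF herm] unfolding A_def by blast
  have "proots (char_poly A) = (\<Sum>k<n. {# complex_of_real (ev k) #})"
    unfolding cp by (subst proots_prod) simp_all
  also have "\<dots> = image_mset (\<lambda>k. of_real (ev k)) (mset_set {..<n})"
    by (simp add: sum_unfold_sum_mset)
  finally have roots: "proots (char_poly A) = image_mset (\<lambda>k. of_real (ev k)) (mset_set {..<n})" .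
  have "size {# x \<in># proots (char_poly A). 0 < x #} = card {k\<in>{..<n}. 0 < ev k}"
    by (simp add: roots filter_mset_image_mset less_complex_def)
  then show "size {# x \<in># proots (char_poly A). 0 < x #} = card {k\<in>K. 0 < d k}"
    using sylvester_law_of_inertia(1)[OF D D'] by simp
  have "size {# x \<in># proots (char_poly A). x < 0 #} = card {k\<in>{..<n}. ev k < 0}"
    by (simp add: roots filter_mset_image_mset less_complex_def)
  then show "size {# x \<in># proots (char_poly A). x < 0 #} = card {k\<in>K. d k < 0}"
    using sylvester_law_of_inertia(2)[OF D D'] by simp
qed

section \<open>Quotients of complex vector spaces\<close>

text \<open>
  The setting for a quotient \<open>U/W\<close>; its elements are handled through representatives in \<open>U\<close>.
\<close>

locale quotient_space = vector_space scale
  for scale :: "complex \<Rightarrow> 'v::ab_group_add \<Rightarrow> 'v" +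
  fixes U W :: "'v set"
  assumes subspace_U: "subspace U" and subspace_W: "subspace W" and W_subset: "W \<subseteq> U"
begin

abbreviation coord :: "'v list \<Rightarrow> nat \<Rightarrow> 'v \<Rightarrow> complex" where
  "coord bs i u \<equiv> coords_mod scale W bs u $ i"

lemma coords_mod_eqI:
  assumes "basis_mod scale U W bs" "u \<in> U" "a \<in> carrier_vec (length bs)"
    and "u - lincomb_list scale bs a \<in> W"
  shows "coords_mod scale W bs u = a"
  unfolding coords_mod_def using assms by (intro the1_equality) (auto simp: basis_mod_def)

lemma coords_mod_spec:
  assumes "basis_mod scale U W bs" "u \<in> U"
  shows "coords_mod scale W bs u \<in> carrier_vec (length bs)"
    and "u - lincomb_list scale bs (coords_mod scale W bs u) \<in> W"
proof -
  have "\<exists>!a. a \<in> carrier_vec (length bs) \<and> u - lincomb_list scale bs a \<in> W"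
    using assms by (auto simp: basis_mod_def)
  from theI'[OF this] show "coords_mod scale W bs u \<in> carrier_vec (length bs)"
    and "u - lincomb_list scale bs (coords_mod scale W bs u) \<in> W"
    unfolding coords_mod_def by blast+
qed

lemma coord_expansion:
  assumes "basis_mod scale U W bs" "u \<in> U"
  shows "u - (\<Sum>i<length bs. scale (coord bs i u) (bs ! i)) \<in> W"
  using coords_mod_spec(2)[OF assms] by (simp add: lincomb_list_def)

lemma coord_eqI:
  assumes "basis_mod scale U W bs" "u \<in> U" "i < length bs"
    and "u - (\<Sum>i<length bs. scale (a i) (bs ! i)) \<in> W"
  shows "coord bs i u = a i"
proof -
  have "lincomb_list scale bs (vec (length bs) a) = (\<Sum>i<length bs. scale (a i) (bs ! i))"
    by (simp add: lincomb_list_def)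
  then have "coords_mod scale W bs u = vec (length bs) a"
    using assms by (intro coords_mod_eqI) auto
  then show ?thesis using assms by simp
qed

lemma coord_sum:
  assumes bs: "basis_mod scale U W bs" and i: "i < length bs" and f: "\<And>k. k \<in> K \<Longrightarrow> f k \<in> U"
  shows "coord bs i (\<Sum>k\<in>K. scale (c k) (f k)) = (\<Sum>k\<in>K. c k * coord bs i (f k))"
proof (rule coord_eqI[OF bs _ i])
  show "(\<Sum>k\<in>K. scale (c k) (f k)) \<in> U"
    using f by (intro subspace_sum subspace_scale subspace_U)
  have "(\<Sum>k\<in>K. scale (c k) (f k - (\<Sum>i<length bs. scale (coord bs i (f k)) (bs ! i)))) \<in> W"
    using f by (intro subspace_sum subspace_scale subspace_W coord_expansion[OF bs])
  also have "(\<Sum>k\<in>K. scale (c k) (f k - (\<Sum>i<length bs. scale (coord bs i (f k)) (bs ! i))))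
     = (\<Sum>k\<in>K. scale (c k) (f k)) - (\<Sum>k\<in>K. \<Sum>i<length bs. scale (c k * coord bs i (f k)) (bs ! i))"
    by (simp add: scale_right_diff_distrib scale_sum_right sum_subtractf)
  also have "(\<Sum>k\<in>K. \<Sum>i<length bs. scale (c k * coord bs i (f k)) (bs ! i))
     = (\<Sum>i<length bs. scale (\<Sum>k\<in>K. c k * coord bs i (f k)) (bs ! i))"
    by (subst sum.swap) (simp add: scale_sum_left)
  finally show "(\<Sum>k\<in>K. scale (c k) (f k))
      - (\<Sum>i<length bs. scale (\<Sum>k\<in>K. c k * coord bs i (f k)) (bs ! i)) \<in> W" .
qed

lemma coord_cong:
  assumes bs: "basis_mod scale U W bs" and i: "i < length bs" and "u \<in> U" "u - u' \<in> W"
  shows "coord bs i u = coord bs i u'"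
proof -
  have "u - (u - u') \<in> U"
    using assms W_subset subspace_diff[OF subspace_U, of u "u - u'"] by blast
  then have u': "u' \<in> U" by simp
  have "(u - u') + (u' - (\<Sum>i<length bs. scale (coord bs i u') (bs ! i))) \<in> W"
    using assms coord_expansion[OF bs u'] by (intro subspace_add subspace_W)
  then show ?thesis by (intro coord_eqI[OF bs \<open>u \<in> U\<close> i]) simp
qed

lemma coord_basis:
  assumes bs: "basis_mod scale U W bs" and "i < length bs" "j < length bs"
  shows "coord bs i (bs ! j) = (if i = j then 1 else 0)"
proof (rule coord_eqI[OF bs])
  have "(\<Sum>i<length bs. scale (if i = j then 1 else 0) (bs ! i))
      = (\<Sum>i<length bs. if i = j then bs ! i else 0)"
    by (intro sum.cong) auto
  also have "\<dots> = bs ! j" using assms by simp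
  finally show "bs ! j - (\<Sum>i<length bs. scale (if i = j then 1 else 0) (bs ! i)) \<in> W"
    using subspace_0[OF subspace_W] by simp
qed (use assms in \<open>auto simp: basis_mod_def\<close>)

text \<open>
  With the coordinate functionals \<open>c\<^sub>i\<close> and \<open>c'\<^sub>j\<close> of the two bases, both sides equal
  \<open>\<Sum>i j. c'\<^sub>j (T b\<^sub>i) c\<^sub>i (b'\<^sub>j)\<close>.
\<close>

lemma trace_basis_independent:
  assumes bs: "basis_mod scale U W bs" and cs: "basis_mod scale U W cs"
    and T_U: "\<And>u. u \<in> U \<Longrightarrow> T u \<in> U" and T_W: "\<And>u. u \<in> W \<Longrightarrow> T u \<in> W"
    and T_add: "\<And>u v. T (u + v) = T u + T v" and T_scale: "\<And>a u. T (scale a u) = scale a (T u)"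
  shows "(\<Sum>i<length bs. coord bs i (T (bs ! i))) = (\<Sum>j<length cs. coord cs j (T (cs ! j)))"
proof -
  have bsU: "bs ! i \<in> U" if "i < length bs" for i
    using bs that by (auto simp: basis_mod_def)
  have csU: "cs ! i \<in> U" if "i < length cs" for i
    using cs that by (auto simp: basis_mod_def)
  have T0: "T 0 = 0" using T_scale[of 0 0] by simp
  have T_sum: "T (\<Sum>i<n. scale (a i) (f i)) = (\<Sum>i<n. scale (a i) (T (f i)))" for a f and n :: nat
    by (induction n) (simp_all add: T0 T_add T_scale)
  have T_diff: "T (u - v) = T u - T v" for u v
    using T_add[of "u - v" v] by (simp add: algebra_simps)
  have "(\<Sum>i<length bs. coord bs i (T (bs ! i)))
      = (\<Sum>i<length bs. \<Sum>j<length cs. coord cs j (T (bs ! i)) * coord bs i (cs ! j))"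
  proof (intro sum.cong refl)
    fix i assume "i \<in> {..<length bs}"
    then have i: "i < length bs" by simp
    have "coord bs i (T (bs ! i)) = coord bs i (\<Sum>j<length cs. scale (coord cs j (T (bs ! i))) (cs ! j))"
      using i by (intro coord_cong[OF bs i] coord_expansion[OF cs] T_U bsU)
    then show "coord bs i (T (bs ! i)) = (\<Sum>j<length cs. coord cs j (T (bs ! i)) * coord bs i (cs ! j))"
      using coord_sum[OF bs i, of "{..<length cs}" "(!) cs"] csU by simp
  qed
  also have "\<dots> = (\<Sum>j<length cs. \<Sum>i<length bs. coord bs i (cs ! j) * coord cs j (T (bs ! i)))"
    by (subst sum.swap) (simp add: mult.commute)
  also have "\<dots> = (\<Sum>j<length cs. coord cs j (T (cs ! j)))"
  proof (intro sum.cong refl)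
    fix j assume "j \<in> {..<length cs}"
    then have j: "j < length cs" by simp
    have "T (cs ! j - (\<Sum>i<length bs. scale (coord bs i (cs ! j)) (bs ! i))) \<in> W"
      using csU j by (intro T_W coord_expansion[OF bs])
    then have "coord cs j (T (cs ! j)) = coord cs j (\<Sum>i<length bs. scale (coord bs i (cs ! j)) (T (bs ! i)))"
      unfolding T_diff T_sum using j by (intro coord_cong[OF cs j] T_U csU)
    then show "(\<Sum>i<length bs. coord bs i (cs ! j) * coord cs j (T (bs ! i))) = coord cs j (T (cs ! j))"
      using coord_sum[OF cs j, of "{..<length bs}" "\<lambda>i. T (bs ! i)"] T_U bsU by simp
  qed
  finally show ?thesis .
qed

text \<open>
  The length of a basis is the trace of the identity, and a complex number determines a natural number.
\<close>

lemma length_basis_unique: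
  assumes bs: "basis_mod scale U W bs" and cs: "basis_mod scale U W cs"
  shows "length bs = length cs"
proof -
  have "(\<Sum>i<length bs. coord bs i (bs ! i)) = (\<Sum>j<length cs. coord cs j (cs ! j))"
    by (rule trace_basis_independent[OF bs cs]) auto
  then have "of_nat (length bs) = (of_nat (length cs) :: complex)"
    by (simp add: coord_basis[OF bs] coord_basis[OF cs])
  then show ?thesis by (simp only: of_nat_eq_iff)
qed

lemma dim_mod_eq_length:
  assumes "basis_mod scale U W bs"
  shows "dim_mod scale U W = length bs"
  unfolding dim_mod_def using assms length_basis_unique by (intro the_equality) blast+

text \<open>
  By a nontrivial relation modulo \<open>W\<close> between the elements of \<open>B\<close>, one of them would be a combination of
  the others, which would then form a smaller spanning set.
\<close>

lemma basis_mod_if_minimal_spanning: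
  assumes B: "finite B" "B \<subseteq> U" and span: "\<And>u. u \<in> U \<Longrightarrow> \<exists>a. u - (\<Sum>b\<in>B. scale (a b) b) \<in> W"
    and minimal: "\<And>B'. B' \<subset> B \<Longrightarrow> \<exists>u\<in>U. \<forall>a. u - (\<Sum>b\<in>B'. scale (a b) b) \<notin> W"
  shows "\<exists>bs. basis_mod scale U W bs"
proof -
  have indep: "c b = 0" if c: "(\<Sum>b\<in>B. scale (c b) b) \<in> W" and b: "b \<in> B" for c b
  proof (rule ccontr)
    assume nz: "c b \<noteq> 0"
    obtain u where u: "u \<in> U" "\<And>a. u - (\<Sum>b\<in>B - {b}. scale (a b) b) \<notin> W"
      using minimal[of "B - {b}"] b by blast
    obtain a where a: "u - (\<Sum>b\<in>B. scale (a b) b) \<in> W" using span u(1) by blast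
    have "(u - (\<Sum>b\<in>B. scale (a b) b)) + scale (a b / c b) (\<Sum>b\<in>B. scale (c b) b) \<in> W"
      using a c by (intro subspace_add subspace_scale subspace_W)
    also have "(u - (\<Sum>b\<in>B. scale (a b) b)) + scale (a b / c b) (\<Sum>b\<in>B. scale (c b) b)
      = u - (\<Sum>b'\<in>B. scale (a b' - a b / c b * c b') b')"
      by (simp add: scale_sum_right scale_left_diff_distrib sum_subtractf)
    also have "(\<Sum>b'\<in>B. scale (a b' - a b / c b * c b') b') = (\<Sum>b'\<in>B - {b}. scale (a b' - a b / c b * c b') b')"
      using B(1) nz b by (intro sum.mono_neutral_right) auto
    finally show False using u(2)[of "\<lambda>b'. a b' - a b / c b * c b'"] by contradiction
  qed
  obtain bs where bs: "set bs = B" "distinct bs" using finite_distinct_list[OF B(1)] by blast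
  have lin: "lincomb_list scale bs a = (\<Sum>b\<in>B. scale (c b) b)"
    if "\<And>i. i < length bs \<Longrightarrow> c (bs ! i) = a $ i" for a c
    unfolding lincomb_list_def bs(1)[symmetric]
    using sum.reindex_bij_betw[OF bij_betw_nth[OF bs(2) refl refl], of "\<lambda>b. scale (c b) b"] that by simp
  have "\<exists>!a. a \<in> carrier_vec (length bs) \<and> u - lincomb_list scale bs a \<in> W" if u: "u \<in> U" for u
  proof (intro ex_ex1I)
    obtain c where "u - (\<Sum>b\<in>B. scale (c b) b) \<in> W" using span u by blast
    then show "\<exists>a. a \<in> carrier_vec (length bs) \<and> u - lincomb_list scale bs a \<in> W"
      by (intro exI[of _ "vec (length bs) (\<lambda>i. c (bs ! i))"]) (simp add: lin[of c])
  next
    fix a a' assume a: "a \<in> carrier_vec (length bs) \<and> u - lincomb_list scale bs a \<in> W"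
      and a': "a' \<in> carrier_vec (length bs) \<and> u - lincomb_list scale bs a' \<in> W"
    define c where "c b = (let i = inv_into {..<length bs} ((!) bs) b in a $ i - a' $ i)" for b
    have c: "c (bs ! i) = a $ i - a' $ i" if "i < length bs" for i
      using that bs(2) by (simp add: c_def inv_into_f_f inj_on_nth)
    have "(\<Sum>b\<in>B. scale (c b) b) = (\<Sum>i<length bs. scale (c (bs ! i)) (bs ! i))"
      using sum.reindex_bij_betw[OF bij_betw_nth[OF bs(2) refl refl], of "\<lambda>b. scale (c b) b"] bs(1) by simp
    also have "\<dots> = lincomb_list scale bs a - lincomb_list scale bs a'"
      by (simp add: lincomb_list_def c scale_left_diff_distrib sum_subtractf)
    also have "\<dots> = (u - lincomb_list scale bs a') - (u - lincomb_list scale bs a)" by simp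
    also have "\<dots> \<in> W"
      by (rule subspace_diff[OF subspace_W]) (use a a' in auto)
    finally have "(\<Sum>b\<in>B. scale (c b) b) \<in> W" .
    from indep[OF this] have "a $ i = a' $ i" if "i < length bs" for i
      using c[OF that] that bs(1) by fastforce
    then show "a = a'" using a a' by (intro eq_vecI) auto
  qed
  then show ?thesis using bs B by (intro exI[of _ bs]) (auto simp: basis_mod_def)
qed

lemma basis_mod_exists:
  assumes B: "finite B" "B \<subseteq> U" and span: "\<And>u. u \<in> U \<Longrightarrow> \<exists>a. u - (\<Sum>b\<in>B. scale (a b) b) \<in> W"
  shows "\<exists>bs. basis_mod scale U W bs"
  using assms
proof (induction B rule: finite_psubset_induct)
  case (psubset B)
  show ?case
  proof (cases "\<exists>B'\<subset>B. \<forall>u\<in>U. \<exists>a. u - (\<Sum>b\<in>B'. scale (a b) b) \<in> W")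
    case True
    then obtain B' where B': "B' \<subset> B" "\<And>u. u \<in> U \<Longrightarrow> \<exists>a. u - (\<Sum>b\<in>B'. scale (a b) b) \<in> W" by blast
    show ?thesis by (rule psubset.IH[OF B'(1)]) (use B' psubset.prems in auto)
  next
    case False
    show ?thesis
    proof (rule basis_mod_if_minimal_spanning[OF psubset.hyps psubset.prems])
      show "\<exists>u\<in>U. \<forall>a. u - (\<Sum>b\<in>B'. scale (a b) b) \<notin> W" if "B' \<subset> B" for B'
        using False that by metis
    qed
  qed
qed

end

section \<open>The polynomial ring, evaluation and the involution\<close>

lemma poly_mapping_sum_singles:
  "f = (\<Sum>m\<in>Poly_Mapping.keys f. Poly_Mapping.single m (Poly_Mapping.lookup f m))"
proof (rule poly_mapping_eqI)
  fix m
  have "Poly_Mapping.lookup (\<Sum>m\<in>Poly_Mapping.keys f. Poly_Mapping.single m (Poly_Mapping.lookup f m)) m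
      = (\<Sum>m'\<in>Poly_Mapping.keys f. if m' = m then Poly_Mapping.lookup f m else 0)"
    by (auto simp: lookup_sum lookup_single when_def intro!: sum.cong)
  then show "Poly_Mapping.lookup f m
      = Poly_Mapping.lookup (\<Sum>m\<in>Poly_Mapping.keys f. Poly_Mapping.single m (Poly_Mapping.lookup f m)) m"
    by (simp add: not_in_keys_iff_lookup_eq_zero)
qed

text \<open>
  The multiplicativity of evaluation and of the involution is reduced by this rule to monomials, one
  factor at a time.
\<close>

lemma poly_mapping_additive_induct [case_names zero single add]:
  fixes f :: "'a \<Rightarrow>\<^sub>0 'b::comm_monoid_add"
  assumes "P 0" "\<And>m a. P (Poly_Mapping.single m a)" "\<And>f g. P f \<Longrightarrow> P g \<Longrightarrow> P (f + g)"
  shows "P f"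
proof -
  have "P (\<Sum>m\<in>A. Poly_Mapping.single m (Poly_Mapping.lookup f m))" if "finite A" for A
    using that by (induction A rule: finite_induct) (auto intro: assms)
  from this[of "Poly_Mapping.keys f"] show ?thesis by (simp flip: poly_mapping_sum_singles)
qed

definition eval_monomial :: "'r::finite point \<Rightarrow> ('r + 'r \<Rightarrow>\<^sub>0 nat) \<Rightarrow> complex" where
  "eval_monomial P m = (\<Prod>k\<in>UNIV. fst P k ^ Poly_Mapping.lookup m (Inl k)) *
         (\<Prod>k\<in>UNIV. snd P k ^ Poly_Mapping.lookup m (Inr k))"

lemma eval_zw_superset:
  assumes "finite A" "Poly_Mapping.keys f \<subseteq> A"
  shows "eval_zw P f = (\<Sum>m\<in>A. Poly_Mapping.lookup f m * eval_monomial P m)"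
  unfolding eval_zw_def eval_monomial_def
  using assms by (intro sum.mono_neutral_left) (auto simp: in_keys_iff)

lemma eval_monomial_0 [simp]: "eval_monomial P 0 = 1"
  by (simp add: eval_monomial_def)

lemma eval_monomial_add: "eval_monomial P (m + n) = eval_monomial P m * eval_monomial P n"
  by (simp add: eval_monomial_def lookup_add power_add prod.distrib mult_ac)

lemma eval_zw_single [simp]: "eval_zw P (Poly_Mapping.single m a) = a * eval_monomial P m"
  by (subst eval_zw_superset[of "{m}"]) auto

lemma eval_zw_0 [simp]: "eval_zw P 0 = 0"
  by (simp add: eval_zw_def)

lemma eval_zw_add [simp]: "eval_zw P (f + g) = eval_zw P f + eval_zw P g"
proof -
  let ?A = "Poly_Mapping.keys f \<union> Poly_Mapping.keys g"
  have "eval_zw P (f + g) = (\<Sum>m\<in>?A. Poly_Mapping.lookup (f + g) m * eval_monomial P m)"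
    using keys_add[of f g] by (intro eval_zw_superset) auto
  also have "\<dots> = (\<Sum>m\<in>?A. Poly_Mapping.lookup f m * eval_monomial P m)
               + (\<Sum>m\<in>?A. Poly_Mapping.lookup g m * eval_monomial P m)"
    by (simp add: lookup_add distrib_right sum.distrib)
  finally show ?thesis by (simp add: eval_zw_superset[of ?A])
qed

lemma eval_zw_mult [simp]: "eval_zw P (f * g) = eval_zw P f * eval_zw P g"
proof (induction f rule: poly_mapping_additive_induct)
  case (single m a)
  show ?case
    by (induction g rule: poly_mapping_additive_induct)
       (simp_all add: mult_single eval_monomial_add distrib_left)
qed (simp_all add: distrib_right)

lemma eval_zw_const [simp]: "eval_zw P (const_poly a) = a"
  by (simp add: const_poly_def)

lemma eval_zw_1 [simp]: "eval_zw P 1 = 1"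
  using eval_zw_const[of P 1] by (simp add: const_poly_def)

lemma eval_zw_uminus [simp]: "eval_zw P (- f) = - eval_zw P f"
  using eval_zw_add[of P f "- f"] by (simp add: eq_neg_iff_add_eq_0 add.commute)

lemma eval_zw_diff [simp]: "eval_zw P (f - g) = eval_zw P f - eval_zw P g"
  using eval_zw_add[of P f "- g"] by simp

lemma eval_zw_sum [simp]: "eval_zw P (\<Sum>k\<in>A. f k) = (\<Sum>k\<in>A. eval_zw P (f k))"
  by (induction A rule: infinite_finite_induct) auto

lemma eval_zw_prod [simp]: "eval_zw P (\<Prod>k\<in>A. f k) = (\<Prod>k\<in>A. eval_zw P (f k))"
  by (induction A rule: infinite_finite_induct) auto

lemma eval_zw_power [simp]: "eval_zw P (f ^ n) = eval_zw P f ^ n"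
  by (induction n) auto

lemma eval_zw_prod_mset [simp]: "eval_zw P (\<Prod>x\<in>#M. f x) = (\<Prod>x\<in>#M. eval_zw P (f x))"
  by (induction M) auto

lemma const_poly_0 [simp]: "const_poly 0 = 0"
  by (simp add: const_poly_def)

lemma const_poly_1 [simp]: "const_poly 1 = 1"
  by (simp add: const_poly_def)

lemma const_poly_add: "const_poly (a + b) = const_poly a + const_poly b"
  by (simp add: const_poly_def single_add)

lemma const_poly_mult: "const_poly (a * b) = const_poly a * const_poly b"
  by (simp add: const_poly_def mult_single)

lemma const_poly_uminus: "const_poly (- a) = - const_poly a"
  by (simp add: const_poly_def single_uminus)

lemma vector_space_scale_poly: "vector_space scale_poly"
  by unfold_locales (simp_all add: const_poly_add const_poly_mult algebra_simps)

lemma swap_exponents_add: "swap_exponents (m + n) = swap_exponents m + swap_exponents n"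
  by (simp add: swap_exponents_def map_key_plus inj_case_sum_Inr_Inl)

lemma star_0 [simp]: "star 0 = 0"
  by (rule poly_mapping_eqI) (simp add: lookup_star)

lemma star_add: "star (f + g) = star f + star g"
  by (rule poly_mapping_eqI) (simp add: lookup_star lookup_add)

lemma star_single: "star (Poly_Mapping.single m a) = Poly_Mapping.single (swap_exponents m) (cnj a)"
proof (rule poly_mapping_eqI)
  fix k
  have "m = swap_exponents k \<longleftrightarrow> swap_exponents m = k" by auto
  then show "Poly_Mapping.lookup (star (Poly_Mapping.single m a)) k
      = Poly_Mapping.lookup (Poly_Mapping.single (swap_exponents m) (cnj a)) k"
    by (simp add: lookup_star lookup_single when_def)
qed

lemma star_mult: "star (f * g) = star f * star g"
proof (induction f rule: poly_mapping_additive_induct)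
  case (single m a)
  show ?case
    by (induction g rule: poly_mapping_additive_induct)
       (simp_all add: mult_single star_single swap_exponents_add distrib_left star_add)
qed (simp_all add: distrib_right star_add)

lemma star_star [simp]: "star (star f) = f"
  by (rule poly_mapping_eqI) (simp add: lookup_star)

lemma star_const: "star (const_poly a) = const_poly (cnj a)"
proof -
  have "swap_exponents 0 = (0 :: 'a + 'a \<Rightarrow>\<^sub>0 nat)"
    by (simp add: swap_exponents_def inj_case_sum_Inr_Inl)
  then show ?thesis by (simp add: const_poly_def star_single)
qed

lemma star_1 [simp]: "star 1 = 1"
  using star_const[of 1] by simp

text \<open>
  The antiholomorphic involution of the space of points that corresponds to \<open>star\<close>; its fixed points
  are the conjugated singles.
\<close>

definition conj_point :: "'r point \<Rightarrow> 'r point" where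
  "conj_point P = (\<lambda>k. cnj (snd P k), \<lambda>k. cnj (fst P k))"

lemma conj_point_conj_point [simp]: "conj_point (conj_point P) = P"
  by (simp add: conj_point_def)

lemma conjugated_single_iff: "conjugated_single P \<longleftrightarrow> conj_point P = P"
  by (cases P) (auto simp: conjugated_single_def conj_point_def fun_eq_iff)

lemma eval_monomial_swap: "eval_monomial P (swap_exponents m) = cnj (eval_monomial (conj_point P) m)"
  by (simp add: eval_monomial_def conj_point_def lookup_swap_exponents mult.commute)

lemma eval_zw_star: "eval_zw P (star f) = cnj (eval_zw (conj_point P) f)"
  by (induction f rule: poly_mapping_additive_induct)
     (simp_all add: star_add star_single eval_monomial_swap)

definition var :: "'r + 'r \<Rightarrow> 'r zw_poly" where
  "var x = Poly_Mapping.single (Poly_Mapping.single x 1) 1"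

definition coordinate :: "'r point \<Rightarrow> 'r + 'r \<Rightarrow> complex" where
  "coordinate P = case_sum (fst P) (snd P)"

lemma point_eqI: "(\<And>x. coordinate P x = coordinate Q x) \<Longrightarrow> P = Q"
proof (rule prod_eqI; rule ext)
  fix k assume eq: "\<And>x. coordinate P x = coordinate Q x"
  show "fst P k = fst Q k" using eq[of "Inl k"] by (simp add: coordinate_def)
  show "snd P k = snd Q k" using eq[of "Inr k"] by (simp add: coordinate_def)
qed

lemma eval_zw_var [simp]: "eval_zw P (var x) = coordinate P x"
proof -
  have "(\<Prod>k\<in>UNIV. c k ^ (if a = k then Suc 0 else 0)) = c a" for c :: "'a \<Rightarrow> complex" and a
  proof -
    have "(\<Prod>k\<in>UNIV. c k ^ (if a = k then Suc 0 else 0)) = (\<Prod>k\<in>UNIV. if a = k then c k else 1)"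
      by (intro prod.cong) auto
    then show ?thesis by simp
  qed
  then show ?thesis
    by (cases x) (simp_all add: var_def eval_monomial_def coordinate_def lookup_single when_def)
qed

lemma zw_poly_induct [case_names const var add mult]:
  fixes f :: "'r::finite zw_poly"
  assumes const: "\<And>a. R (const_poly a)" and var: "\<And>x. R (var x)"
    and add: "\<And>f g. R f \<Longrightarrow> R g \<Longrightarrow> R (f + g)" and mult: "\<And>f g. R f \<Longrightarrow> R g \<Longrightarrow> R (f * g)"
  shows "R f"
proof (induction f rule: poly_mapping_additive_induct)
  case zero
  then show ?case using const[of 0] by simp
next
  case (single m a)
  have one: "R 1" using const[of 1] by simp
  have R_power: "R (var x ^ k)" for x k by (induction k) (simp_all add: one var mult)
  have R_prod: "R (\<Prod>x\<in>A. f x)" if "\<And>x. R (f x)" for f and A :: "('r + 'r) set"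
    by (induction A rule: infinite_finite_induct) (simp_all add: one mult that)
  have var_power: "var x ^ k = Poly_Mapping.single (Poly_Mapping.single x k) 1" for x :: "'r + 'r" and k
    by (induction k) (simp_all add: var_def mult_single single_add[symmetric])
  have monomial: "Poly_Mapping.single (\<Sum>x\<in>A. Poly_Mapping.single x (e x)) 1 = (\<Prod>x\<in>A. var x ^ e x)"
    for A and e :: "'r + 'r \<Rightarrow> nat"
  proof (induction A rule: infinite_finite_induct)
    case (insert x A)
    have "Poly_Mapping.single (Poly_Mapping.single x (e x) + (\<Sum>x\<in>A. Poly_Mapping.single x (e x))) (1::complex)
        = Poly_Mapping.single (Poly_Mapping.single x (e x)) 1 * Poly_Mapping.single (\<Sum>x\<in>A. Poly_Mapping.single x (e x)) 1"
      by (simp add: mult_single)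
    with insert show ?case by (simp add: var_power)
  qed simp_all
  have "(\<Sum>x\<in>UNIV. Poly_Mapping.single x (Poly_Mapping.lookup m x)) = m"
    by (rule poly_mapping_eqI) (simp add: lookup_sum lookup_single when_def)
  then have "(\<Prod>x\<in>UNIV. var x ^ Poly_Mapping.lookup m x) = Poly_Mapping.single m 1"
    using monomial[of "Poly_Mapping.lookup m" UNIV] by simp
  then have "Poly_Mapping.single m a = const_poly a * (\<Prod>x\<in>UNIV. var x ^ Poly_Mapping.lookup m x)"
    by (simp add: const_poly_def mult_single)
  moreover have "R (const_poly a * (\<Prod>x\<in>UNIV. var x ^ Poly_Mapping.lookup m x))"
    by (rule mult[OF const R_prod]) (rule R_power)
  ultimately show ?case by (simp only:)
qed (rule add)

section \<open>The Nullstellensatz for zero-dimensional ideals\<close>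

text \<open>
  Ideals of the whole ring type, as a closure condition on a set; this is \<open>subspace\<close> of the ring as a
  module over itself.
\<close>

definition is_ideal :: "'a::comm_ring_1 set \<Rightarrow> bool" where
  "is_ideal J \<longleftrightarrow> 0 \<in> J \<and> (\<forall>f\<in>J. \<forall>g\<in>J. f + g \<in> J) \<and> (\<forall>f\<in>J. \<forall>h. h * f \<in> J)"

lemma is_ideal_0: "is_ideal J \<Longrightarrow> 0 \<in> J"
  and is_ideal_add: "is_ideal J \<Longrightarrow> f \<in> J \<Longrightarrow> g \<in> J \<Longrightarrow> f + g \<in> J"
  and is_ideal_mult: "is_ideal J \<Longrightarrow> f \<in> J \<Longrightarrow> h * f \<in> J"
  by (auto simp: is_ideal_def)

lemma is_ideal_mult_right: "is_ideal J \<Longrightarrow> f \<in> J \<Longrightarrow> f * h \<in> J"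
  by (metis is_ideal_mult mult.commute)

lemma is_ideal_uminus: "is_ideal J \<Longrightarrow> f \<in> J \<Longrightarrow> - f \<in> J"
  using is_ideal_mult[of J f "- 1"] by simp

lemma is_ideal_diff: "is_ideal J \<Longrightarrow> f \<in> J \<Longrightarrow> g \<in> J \<Longrightarrow> f - g \<in> J"
  using is_ideal_add[of J f "- g"] is_ideal_uminus[of J g] by simp

lemma module_times: "Modules.module ((*) :: 'a::comm_ring_1 \<Rightarrow> 'a \<Rightarrow> 'a)"
  by unfold_locales (simp_all add: algebra_simps)

lemma is_ideal_generated: "is_ideal (ideal_generated S)"
  unfolding is_ideal_def ideal_generated_def
  by (simp add: Modules.module.span_zero[OF module_times] Modules.module.span_add[OF module_times]
      Modules.module.span_scale[OF module_times])

text \<open>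
  The ideal generated by an ideal \<open>J\<close> and an element \<open>h\<close>.
\<close>

definition adjoin :: "'a::comm_ring_1 set \<Rightarrow> 'a \<Rightarrow> 'a set" where
  "adjoin J h = {f. \<exists>g. f - g * h \<in> J}"

lemma is_ideal_adjoin:
  assumes J: "is_ideal J"
  shows "is_ideal (adjoin J h)"
  unfolding is_ideal_def
proof (intro conjI ballI allI)
  show "0 \<in> adjoin J h"
    using is_ideal_0[OF J] by (auto simp: adjoin_def intro!: exI[of _ 0])
  fix f f' assume "f \<in> adjoin J h" "f' \<in> adjoin J h"
  then obtain g g' where "f - g * h \<in> J" "f' - g' * h \<in> J" by (auto simp: adjoin_def)
  then have "(f - g * h) + (f' - g' * h) \<in> J" by (rule is_ideal_add[OF J])
  then have "f + f' - (g + g') * h \<in> J" by (simp add: algebra_simps)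
  then show "f + f' \<in> adjoin J h" by (auto simp: adjoin_def)
next
  fix f k assume "f \<in> adjoin J h"
  then obtain g where "f - g * h \<in> J" by (auto simp: adjoin_def)
  then have "k * (f - g * h) \<in> J" by (rule is_ideal_mult[OF J])
  then have "k * f - (k * g) * h \<in> J" by (simp add: algebra_simps)
  then show "k * f \<in> adjoin J h" by (auto simp: adjoin_def)
qed

lemma subset_adjoin: "J \<subseteq> adjoin J h"
  by (auto simp: adjoin_def intro!: exI[of _ 0])

lemma in_adjoin: "is_ideal J \<Longrightarrow> h \<in> adjoin J h"
  by (auto simp: adjoin_def is_ideal_0 intro!: exI[of _ 1])

text \<open>
  A zero-dimensional ideal comes with a chosen basis of the quotient, which makes multiplication maps
  matrices.
\<close>

locale zero_dim_ideal =
  fixes I :: "'r::finite zw_poly set" and bs :: "'r zw_poly list"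
  assumes ideal: "is_ideal I" and basis: "quotient_basis I bs"
begin

sublocale quotient_space scale_poly UNIV I
proof (intro quotient_space.intro quotient_space_axioms.intro)
  interpret vector_space "scale_poly :: complex \<Rightarrow> 'r zw_poly \<Rightarrow> 'r zw_poly"
    by (rule vector_space_scale_poly)
  show "vector_space (scale_poly :: complex \<Rightarrow> 'r zw_poly \<Rightarrow> 'r zw_poly)"
    by (rule vector_space_scale_poly)
  show "subspace UNIV" by simp
  show "subspace I" using ideal by (auto simp: subspace_def is_ideal_def)
qed simp

abbreviation V :: "'r point set" where "V \<equiv> zero_set I"

lemma in_ideal_if_coords_0:
  assumes "\<And>i. i < length bs \<Longrightarrow> coord bs i u = 0"
  shows "u \<in> I"
  using coord_expansion[OF basis, of u] assms by simp

text \<open>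
  The powers \<open>1, h, \<dots>, h\<^sup>n\<close> are linearly dependent modulo \<open>I\<close>, where \<open>n\<close> is the dimension of the
  quotient; so \<open>q(h) \<in> I\<close> for some nonzero univariate \<open>q\<close>, which splits into linear factors.
\<close>

lemma annihilating_product: "\<exists>M. (\<Prod>x\<in>#M. h - const_poly x) \<in> I"
proof -
  interpret hom: map_poly_comm_ring_hom "const_poly :: complex \<Rightarrow> 'r zw_poly"
    by unfold_locales (simp_all add: const_poly_add const_poly_mult const_poly_uminus)
  define \<phi> where "\<phi> q = poly (map_poly const_poly q) h" for q :: "complex poly"
  have \<phi>_add: "\<phi> (p + q) = \<phi> p + \<phi> q" and \<phi>_mult: "\<phi> (p * q) = \<phi> p * \<phi> q" for p q
    by (simp_all add: \<phi>_def hom.hom_add hom.hom_mult)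
  have \<phi>_monom: "\<phi> (monom c k) = const_poly c * h ^ k" for c k
    by (simp add: \<phi>_def map_poly_monom poly_monom)
  have \<phi>_sum: "\<phi> (\<Sum>k\<in>A. f k) = (\<Sum>k\<in>A. \<phi> (f k))" for f and A :: "nat set"
    using \<phi>_monom[of 0 0] by (induction A rule: infinite_finite_induct) (simp_all add: \<phi>_add)
  obtain c where c: "\<exists>k\<in>{..length bs}. c k \<noteq> 0"
    and c0: "\<And>i. i < length bs \<Longrightarrow> (\<Sum>k\<in>{..length bs}. c k * coord bs i (h ^ k)) = 0"
    using homogeneous_system_nontrivial[of "{..length bs}" "{..<length bs}" "\<lambda>i k. coord bs i (h ^ k)"]
    by auto
  \<comment> \<open>There are \<open>length bs + 1\<close> powers but only \<open>length bs\<close> coordinates, hence a relation.\<close>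
  define q where "q = (\<Sum>k\<in>{..length bs}. monom (c k) k)"
  have "coeff q k = c k" if "k \<le> length bs" for k
    using that by (simp add: q_def coeff_sum)
  then have "q \<noteq> 0" using c by (metis atMost_iff coeff_0)
  have "\<phi> q = (\<Sum>k\<in>{..length bs}. const_poly (c k) * h ^ k)"
    by (simp add: q_def \<phi>_sum \<phi>_monom)
  then have "\<phi> q \<in> I"
    using coord_sum[OF basis, of _ "{..length bs}" "\<lambda>k. h ^ k" c] c0
    by (intro in_ideal_if_coords_0) simp
  obtain as where as: "Polynomial.smult (lead_coeff q) (\<Prod>a\<leftarrow>as. [:- a, 1:]) = q"
    using fundamental_theorem_algebra_factorized by blast
  have "\<phi> (\<Prod>a\<leftarrow>as. [:- a, 1:]) = (\<Prod>x\<in>#mset as. h - const_poly x)"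
  proof (induction as)
    case Nil
    show ?case by (simp add: \<phi>_def)
  next
    case (Cons a as)
    have "\<phi> [:- a, 1:] = h - const_poly a"
      by (simp add: \<phi>_def map_poly_pCons const_poly_uminus)
    then show ?case using Cons by (simp add: \<phi>_mult del: mult_pCons_left)
  qed
  moreover have "\<phi> (Polynomial.smult c p) = const_poly c * \<phi> p" for c p
    using \<phi>_mult[of "[:c:]" p] \<phi>_monom[of c 0] by (simp add: monom_0)
  ultimately have \<phi>_q: "\<phi> q = const_poly (lead_coeff q) * (\<Prod>x\<in>#mset as. h - const_poly x)"
    using as by metis
  have "const_poly (1 / lead_coeff q) * (const_poly (lead_coeff q) * (\<Prod>x\<in>#mset as. h - const_poly x)) \<in> I"
    using is_ideal_mult[OF ideal \<open>\<phi> q \<in> I\<close>] unfolding \<phi>_q .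
  then have "(\<Prod>x\<in>#mset as. h - const_poly x) \<in> I"
    using \<open>q \<noteq> 0\<close> by (simp add: mult.assoc[symmetric] const_poly_mult[symmetric])
  then show ?thesis by blast
qed

text \<open>
  If every \<open>h - x\<close> were a unit modulo \<open>J\<close>, then so would be every product of such elements, although
  one of them lies in \<open>I \<subseteq> J\<close>.
\<close>

lemma proper_adjoin_exists:
  assumes J: "is_ideal J" "I \<subseteq> J" "1 \<notin> J"
  shows "\<exists>x. 1 \<notin> adjoin J (h - const_poly x)"
proof (rule ccontr)
  assume "\<not> ?thesis"
  then have unit: "\<exists>g. 1 - g * (h - const_poly x) \<in> J" for x by (auto simp: adjoin_def)
  have "\<exists>g. 1 - g * (\<Prod>x\<in>#M. h - const_poly x) \<in> J" for M
  proof (induction M)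
    case empty
    show ?case using is_ideal_0[OF J(1)] by (intro exI[of _ 1]) simp
  next
    case (add x M)
    let ?p = "\<Prod>x\<in>#M. h - const_poly x"
    from add obtain g where g: "1 - g * ?p \<in> J" by blast
    from unit obtain g' where g': "1 - g' * (h - const_poly x) \<in> J" by blast
    have "(1 - g' * (h - const_poly x)) + (g' * (h - const_poly x)) * (1 - g * ?p) \<in> J"
      using g g' by (intro is_ideal_add[OF J(1)] is_ideal_mult[OF J(1)])
    also have "(1 - g' * (h - const_poly x)) + (g' * (h - const_poly x)) * (1 - g * ?p)
        = 1 - (g * g') * ((h - const_poly x) * ?p)"
      by (simp add: algebra_simps)
    finally show ?case by auto
  qed
  moreover obtain M where "(\<Prod>x\<in>#M. h - const_poly x) \<in> I" using annihilating_product by blast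
  ultimately obtain g where "1 - g * (\<Prod>x\<in>#M. h - const_poly x) \<in> J"
    "g * (\<Prod>x\<in>#M. h - const_poly x) \<in> J"
    using J is_ideal_mult by blast
  from is_ideal_add[OF J(1) this] show False using J(3) by simp
qed

text \<open>
  A proper ideal can be enlarged, one variable at a time, until it contains \<open>x - c\<^sub>x\<close> for each
  variable \<open>x\<close> in \<open>A\<close>.
\<close>

lemma maximal_point_ideal_exists:
  assumes J: "is_ideal J" "I \<subseteq> J" "1 \<notin> J" and A: "finite A"
  shows "\<exists>J' c. is_ideal J' \<and> J \<subseteq> J' \<and> 1 \<notin> J' \<and> (\<forall>x\<in>A. var x - const_poly (c x) \<in> J')"
  using A
proof (induction A rule: finite_induct)
  case empty
  show ?case using J by auto
next
  case (insert x A)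
  then obtain J' c where J': "is_ideal J'" "J \<subseteq> J'" "1 \<notin> J'"
    and c: "\<And>y. y \<in> A \<Longrightarrow> var y - const_poly (c y) \<in> J'" by blast
  from J J' have "I \<subseteq> J'" by blast
  from proper_adjoin_exists[OF J'(1) this J'(3), of "var x"] obtain a where
    a: "1 \<notin> adjoin J' (var x - const_poly a)" by blast
  show ?case
  proof (intro exI[of _ "adjoin J' (var x - const_poly a)"] exI[of _ "c(x := a)"] conjI ballI)
    show "is_ideal (adjoin J' (var x - const_poly a))" by (rule is_ideal_adjoin[OF J'(1)])
    show "J \<subseteq> adjoin J' (var x - const_poly a)"
      using J'(2) subset_adjoin by (rule order_trans)
    fix y assume "y \<in> insert x A"
    then show "var y - const_poly ((c(x := a)) y) \<in> adjoin J' (var x - const_poly a)"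
      using c in_adjoin[OF J'(1)] subsetD[OF subset_adjoin[of J']] insert.hyps by (cases "y = x") auto
  qed (rule a)
qed

text \<open>
  An ideal that contains all \<open>x - c\<^sub>x\<close> identifies every polynomial with its value at the point \<open>c\<close>; if
  the ideal is proper, its elements must have value zero there.
\<close>

theorem weak_nullstellensatz:
  assumes J: "is_ideal J" "I \<subseteq> J" "1 \<notin> J"
  shows "\<exists>P. \<forall>f\<in>J. eval_zw P f = 0"
proof -
  obtain J' c where J': "is_ideal J'" "J \<subseteq> J'" "1 \<notin> J'"
    and c: "\<And>x. var x - const_poly (c x) \<in> J'"
    using maximal_point_ideal_exists[OF J, of UNIV] by auto
  define P where "P = (\<lambda>k. c (Inl k), \<lambda>k. c (Inr k))"
  have coord_P: "coordinate P x = c x" for x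
    by (cases x) (simp_all add: P_def coordinate_def)
  have cong: "f - const_poly (eval_zw P f) \<in> J'" for f
  proof (induction f rule: zw_poly_induct)
    case (const a)
    then show ?case using is_ideal_0[OF J'(1)] by simp
  next
    case (var x)
    then show ?case using c by (simp add: coord_P)
  next
    case (add f g)
    from is_ideal_add[OF J'(1) this] show ?case by (simp add: const_poly_add algebra_simps)
  next
    case (mult f g)
    have "g * (f - const_poly (eval_zw P f)) + const_poly (eval_zw P f) * (g - const_poly (eval_zw P g)) \<in> J'"
      using mult by (intro is_ideal_add[OF J'(1)] is_ideal_mult[OF J'(1)])
    then show ?case by (simp add: const_poly_mult algebra_simps)
  qed
  have "eval_zw P f = 0" if "f \<in> J" for f
  proof (rule ccontr)
    assume nz: "eval_zw P f \<noteq> 0"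
    have "f - (f - const_poly (eval_zw P f)) \<in> J'"
      using that J'(2) cong by (blast intro: is_ideal_diff[OF J'(1)])
    then have "const_poly (1 / eval_zw P f) * const_poly (eval_zw P f) \<in> J'"
      by (intro is_ideal_mult[OF J'(1)]) simp
    then show False using nz J'(3) by (simp flip: const_poly_mult)
  qed
  then show ?thesis by blast
qed

text \<open>
  Otherwise \<open>I\<close> and \<open>s\<close> would generate a proper ideal, which has a zero.
\<close>

lemma unit_if_nonvanishing:
  assumes "\<And>P. P \<in> V \<Longrightarrow> eval_zw P s \<noteq> 0"
  shows "\<exists>t. 1 - t * s \<in> I"
proof (rule ccontr)
  assume "\<not> ?thesis"
  then have "1 \<notin> adjoin I s" by (auto simp: adjoin_def)
  from weak_nullstellensatz[OF is_ideal_adjoin[OF ideal] subset_adjoin this]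
  obtain P where P: "\<And>f. f \<in> adjoin I s \<Longrightarrow> eval_zw P f = 0" by blast
  then have "P \<in> V" using subset_adjoin by (auto simp: zero_set_def)
  then show False using P[OF in_adjoin[OF ideal]] assms by blast
qed

text \<open>
  The coordinates of a zero are roots of the univariate polynomials that annihilate the variables
  modulo \<open>I\<close>.
\<close>

lemma finite_zero_set: "finite V"
proof -
  obtain M where M: "\<And>x. (\<Prod>a\<in>#M x. var x - const_poly a) \<in> I"
    using choice[of "\<lambda>x M. (\<Prod>a\<in>#M. var x - const_poly a) \<in> I"] annihilating_product by blast
  have "coordinate P x \<in> set_mset (M x)" if "P \<in> V" for P x
  proof -
    have "eval_zw P (\<Prod>a\<in>#M x. var x - const_poly a) = 0" using that M unfolding zero_set_def by blast
    then have "(\<Prod>a\<in>#M x. coordinate P x - a) = 0" by simp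
    then show ?thesis by (auto simp: prod_mset_zero_iff)
  qed
  then have "coordinate ` V \<subseteq> PiE UNIV (\<lambda>x. set_mset (M x))" by auto
  moreover have "finite (PiE UNIV (\<lambda>x. set_mset (M x)))" by (intro finite_PiE) auto
  ultimately have "finite (coordinate ` V)" by (rule finite_subset)
  moreover have "inj_on coordinate V" by (intro inj_onI point_eqI) simp
  ultimately show ?thesis by (rule finite_imageD)
qed

end

lemma separating_poly:
  assumes "P \<noteq> Q"
  shows "\<exists>h. eval_zw P h = 1 \<and> eval_zw Q h = 0"
proof -
  from assms obtain x where x: "coordinate P x \<noteq> coordinate Q x" using point_eqI by blast
  then show ?thesis
    by (intro exI[of _ "const_poly (1 / (coordinate P x - coordinate Q x)) * (var x - const_poly (coordinate Q x))"])
       simp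
qed

text \<open>
  Lagrange interpolation: the products of polynomials that separate \<open>P\<close> from one other point each.
\<close>

lemma interpolation_polys_exist:
  assumes "finite S"
  shows "\<exists>e. \<forall>P\<in>S. \<forall>Q\<in>S. eval_zw Q (e P) = (if P = Q then 1 else 0)"
proof -
  have ex: "\<exists>e. \<forall>Q\<in>S. eval_zw Q e = (if P = Q then 1 else 0)" for P :: "'a point"
  proof -
    have "\<exists>h. P \<noteq> Q \<longrightarrow> eval_zw P h = 1 \<and> eval_zw Q h = 0" for Q
      using separating_poly by blast
    then obtain h where h: "\<And>Q. P \<noteq> Q \<longrightarrow> eval_zw P (h Q) = 1 \<and> eval_zw Q (h Q) = 0"
      using choice[of "\<lambda>Q h. P \<noteq> Q \<longrightarrow> eval_zw P h = 1 \<and> eval_zw Q h = 0"] by blast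
    have "eval_zw Q (\<Prod>R\<in>S - {P}. h R) = (if P = Q then 1 else 0)" if "Q \<in> S" for Q
    proof (cases "P = Q")
      case True
      have "eval_zw P (h R) = 1" if "R \<in> S - {P}" for R
        using h[of R] that by blast
      then show ?thesis unfolding True[symmetric] eval_zw_prod by simp
    next
      case False
      then have "Q \<in> S - {P}" "eval_zw Q (h Q) = 0" using that h[of Q] by simp_all
      then have "(\<Prod>R\<in>S - {P}. eval_zw Q (h R)) = 0" using assms by (meson finite_Diff prod_zero)
      then show ?thesis using False by simp
    qed
    then show ?thesis by blast
  qed
  from choice[of "\<lambda>P e. \<forall>Q\<in>S. eval_zw Q e = (if P = Q then 1 else 0)"] ex
  show ?thesis by blast
qed

section \<open>The trace of multiplication maps\<close>

context zero_dim_ideal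
begin

definition mult_trace :: "'r zw_poly \<Rightarrow> complex" where
  "mult_trace f = (\<Sum>i<length bs. coord bs i (bs ! i * f))"

definition mult_matrix :: "'r zw_poly \<Rightarrow> complex mat" where
  "mult_matrix f = mat (length bs) (length bs) (\<lambda>(i, j). coord bs i (bs ! j * f))"

lemma mult_matrix_carrier [simp]: "mult_matrix f \<in> carrier_mat (length bs) (length bs)"
  by (simp add: mult_matrix_def)

lemma mat_trace_mult_matrix: "mat_trace (mult_matrix f) = mult_trace f"
  by (simp add: mat_trace_def mult_matrix_def mult_trace_def)

lemma coord_sum_poly: "i < length bs \<Longrightarrow>
    coord bs i (\<Sum>k\<in>K. const_poly (c k) * f k) = (\<Sum>k\<in>K. c k * coord bs i (f k))"
  using coord_sum[OF basis, of i K f c] by simp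

lemma coord_in_ideal: "i < length bs \<Longrightarrow> u \<in> I \<Longrightarrow> coord bs i u = 0"
  using coord_cong[OF basis, of i u 0] coord_sum_poly[where K = "{}" and i = i] by simp

lemma eval_expansion:
  assumes "P \<in> V"
  shows "eval_zw P u = (\<Sum>i<length bs. coord bs i u * eval_zw P (bs ! i))"
proof -
  have "eval_zw P (u - (\<Sum>i<length bs. const_poly (coord bs i u) * bs ! i)) = 0"
    using coord_expansion[OF basis, of u] assms unfolding zero_set_def by blast
  then show ?thesis by simp
qed

text \<open>
  If \<open>f - x\<close> had no zero in \<open>V\<close>, it would be a unit modulo \<open>I\<close>, and an eigenvector \<open>h\<close>, for which
  \<open>(f - x) h \<in> I\<close>, would be zero in the quotient.
\<close>

lemma eigenvalue_imp_value:
  assumes "eigenvalue (mult_matrix f) x"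
  shows "\<exists>P\<in>V. eval_zw P f = x"
proof (rule ccontr)
  assume no: "\<not> ?thesis"
  let ?n = "length bs"
  obtain v where v: "v \<in> carrier_vec ?n" "v \<noteq> 0\<^sub>v ?n" "mult_matrix f *\<^sub>v v = x \<cdot>\<^sub>v v"
    using assms by (auto simp: eigenvalue_def eigenvector_def mult_matrix_def)
  define h where "h = (\<Sum>j<?n. const_poly (v $ j) * bs ! j)"
  have coord_h: "coord bs i h = v $ i" if "i < ?n" for i
  proof -
    have "coord bs i h = (\<Sum>j<?n. v $ j * (if i = j then 1 else 0))"
      unfolding h_def coord_sum_poly[OF that] using that by (simp add: coord_basis[OF basis])
    also have "\<dots> = (\<Sum>j<?n. if i = j then v $ j else 0)" by (intro sum.cong) auto
    finally show ?thesis using that by simp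
  qed
  have coord_fh: "coord bs i (h * f) = x * v $ i" if "i < ?n" for i
  proof -
    have "h * f = (\<Sum>j<?n. const_poly (v $ j) * (bs ! j * f))"
      by (simp add: h_def sum_distrib_right mult.assoc)
    then have "coord bs i (h * f) = (\<Sum>j<?n. v $ j * coord bs i (bs ! j * f))"
      by (simp only: coord_sum_poly[OF that])
    also have "\<dots> = (mult_matrix f *\<^sub>v v) $ i"
      using that v(1) by (auto simp: mult_matrix_def scalar_prod_def atLeast0LessThan mult.commute intro!: sum.cong)
    finally show ?thesis using v that by simp
  qed
  have eigen: "(f - const_poly x) * h \<in> I"
  proof (rule in_ideal_if_coords_0)
    fix i assume i: "i < ?n"
    have "(f - const_poly x) * h = (\<Sum>k\<in>{True, False}. const_poly (if k then 1 else - x) * (if k then h * f else h))"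
      by (simp add: algebra_simps const_poly_uminus)
    then have "coord bs i ((f - const_poly x) * h)
        = (\<Sum>k\<in>{True, False}. (if k then 1 else - x) * coord bs i (if k then h * f else h))"
      by (simp only: coord_sum_poly[OF i])
    then show "coord bs i ((f - const_poly x) * h) = 0" using i by (simp add: coord_h coord_fh)
  qed
  have "eval_zw P (f - const_poly x) \<noteq> 0" if "P \<in> V" for P using no that by simp
  then obtain t where t: "1 - t * (f - const_poly x) \<in> I" using unit_if_nonvanishing by blast
  have "h * (1 - t * (f - const_poly x)) + t * ((f - const_poly x) * h) \<in> I"
    by (rule is_ideal_add[OF ideal is_ideal_mult[OF ideal t] is_ideal_mult[OF ideal eigen]])
  also have "h * (1 - t * (f - const_poly x)) + t * ((f - const_poly x) * h) = h"
    by (simp add: algebra_simps)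
  finally have "h \<in> I" .
  then have "v $ i = 0" if "i < ?n" for i
    using coord_h[OF that] coord_in_ideal[OF that] by simp
  then have "v = 0\<^sub>v ?n" using v(1) by (intro eq_vecI) auto
  with v(2) show False by simp
qed

text \<open>
  The values of the basis elements at \<open>P\<close> form an eigenvector of the transposed matrix, as evaluation at
  \<open>P\<close> is a ring homomorphism on the quotient.
\<close>

lemma value_imp_eigenvalue:
  assumes P: "P \<in> V"
  shows "eigenvalue (mult_matrix f) (eval_zw P f)"
proof -
  let ?n = "length bs"
  let ?A = "transpose_mat (mult_matrix f)"
  define w where "w = vec ?n (\<lambda>i. eval_zw P (bs ! i))"
  have "?A *\<^sub>v w = eval_zw P f \<cdot>\<^sub>v w"
  proof (rule eq_vecI)
    fix j assume "j < dim_vec (eval_zw P f \<cdot>\<^sub>v w)"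
    then have j: "j < ?n" by (simp add: w_def)
    then have "(?A *\<^sub>v w) $ j = (\<Sum>i<?n. coord bs i (bs ! j * f) * eval_zw P (bs ! i))"
      by (simp add: w_def mult_matrix_def scalar_prod_def atLeast0LessThan)
    also have "\<dots> = eval_zw P (bs ! j * f)" by (rule eval_expansion[OF P, symmetric])
    finally show "(?A *\<^sub>v w) $ j = (eval_zw P f \<cdot>\<^sub>v w) $ j" using j by (simp add: w_def)
  qed (simp add: w_def mult_matrix_def)
  moreover have "w \<noteq> 0\<^sub>v ?n"
  proof
    assume "w = 0\<^sub>v ?n"
    then have "eval_zw P (bs ! i) = 0" if "i < ?n" for i
      using that by (metis index_vec index_zero_vec(1) w_def)
    then have "eval_zw P 1 = 0" using eval_expansion[OF P, of 1] by simp
    then show False by simp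
  qed
  ultimately have "eigenvalue ?A (eval_zw P f)"
    unfolding eigenvalue_def eigenvector_def by (intro exI[of _ w]) (simp add: w_def mult_matrix_def)
  then show ?thesis
    by (simp add: eigenvalue_root_char_poly[of _ ?n] char_poly_transpose_mat[of _ ?n])
qed

theorem stickelberger: "eigenvalue (mult_matrix f) x \<longleftrightarrow> x \<in> (\<lambda>P. eval_zw P f) ` V"
  using eigenvalue_imp_value value_imp_eigenvalue by (auto simp: image_iff)

lemma mult_trace_eq_sum_of_values:
  obtains es where "mult_trace f = sum_list es" "set es = (\<lambda>P. eval_zw P f) ` V"
proof -
  obtain es where es: "char_poly (mult_matrix f) = (\<Prod>e\<leftarrow>es. [:- e, 1:])"
    using char_poly_factorized[OF mult_matrix_carrier] by blast
  show thesis
  proof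
    show "mult_trace f = sum_list es"
      using mat_trace_eq_sum_eigenvalues(1)[OF mult_matrix_carrier es] by (simp add: mat_trace_mult_matrix)
    show "set es = (\<lambda>P. eval_zw P f) ` V"
      using eigenvalue_iff_in_linear_factors[OF mult_matrix_carrier es] stickelberger by blast
  qed
qed

lemma mult_trace_linear_combination: "mult_trace (\<Sum>k\<in>K. const_poly (c k) * f k) = (\<Sum>k\<in>K. c k * mult_trace (f k))"
proof -
  have "bs ! i * (\<Sum>k\<in>K. const_poly (c k) * f k) = (\<Sum>k\<in>K. const_poly (c k) * (bs ! i * f k))" for i
    by (simp add: sum_distrib_left mult.left_commute)
  then have "mult_trace (\<Sum>k\<in>K. const_poly (c k) * f k) = (\<Sum>i<length bs. \<Sum>k\<in>K. c k * coord bs i (bs ! i * f k))"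
    unfolding mult_trace_def by (intro sum.cong) (simp_all add: coord_sum_poly)
  then show ?thesis by (subst (asm) sum.swap) (simp add: mult_trace_def sum_distrib_left)
qed

text \<open>
  All eigenvalues of multiplication by \<open>f - g\<close> are zero.
\<close>

lemma mult_trace_eq_if_values_eq:
  assumes "\<And>P. P \<in> V \<Longrightarrow> eval_zw P f = eval_zw P g"
  shows "mult_trace f = mult_trace g"
proof -
  obtain es where es: "mult_trace (f - g) = sum_list es" "set es = (\<lambda>P. eval_zw P (f - g)) ` V"
    by (rule mult_trace_eq_sum_of_values)
  have "e = 0" if "e \<in> set es" for e using that assms unfolding es(2) by auto
  then have "map (\<lambda>e. e) es = map (\<lambda>_. 0) es" by (intro map_cong) auto
  then have "mult_trace (f - g) = 0" unfolding es(1) by (metis map_ident sum_list_0)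
  moreover have "mult_trace (f - g) = (\<Sum>k\<in>{True, False}. (if k then 1 else - 1) * mult_trace (if k then f else g))"
    by (subst mult_trace_linear_combination[symmetric]) (simp add: const_poly_uminus)
  ultimately show ?thesis by simp
qed

text \<open>
  The eigenvalues of multiplication by \<open>e\<close> are among \<open>0\<close> and \<open>1\<close>, and \<open>1\<close> is one of them; so the trace
  counts how often it occurs.
\<close>

lemma mult_trace_indicator:
  assumes P: "P \<in> V" and e: "\<And>Q. Q \<in> V \<Longrightarrow> eval_zw Q e = (if P = Q then 1 else 0)"
  shows "\<exists>m::nat. m > 0 \<and> mult_trace e = of_nat m"
proof -
  obtain es where es: "mult_trace e = sum_list es" "set es = (\<lambda>P. eval_zw P e) ` V"
    by (rule mult_trace_eq_sum_of_values)
  have "set es \<subseteq> {0, 1}" unfolding es(2) using e by auto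
  then have "sum_list es = of_nat (count_list es 1)"
    by (induction es) auto
  moreover have "1 \<in> set es" unfolding es(2) using e P by (auto simp: image_iff intro!: bexI[of _ P])
  then have "count_list es 1 > 0" using count_list_0_iff[of es 1] by (intro gr0I) simp
  ultimately show ?thesis using es(1) by (intro exI[of _ "count_list es 1"] conjI) simp_all
qed

text \<open>
  Since the trace depends only on the values of \<open>f\<close> on \<open>V\<close>, the polynomial \<open>f\<close> may be replaced by its
  Lagrange interpolation.
\<close>

theorem trace_formula:
  "\<exists>m::'r point \<Rightarrow> nat. (\<forall>P\<in>V. m P > 0) \<and> (\<forall>f. mult_trace f = (\<Sum>P\<in>V. of_nat (m P) * eval_zw P f))"
proof -
  obtain e where e: "\<And>P Q. P \<in> V \<Longrightarrow> Q \<in> V \<Longrightarrow> eval_zw Q (e P) = (if P = Q then 1 else 0)"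
    using interpolation_polys_exist[OF finite_zero_set] by blast
  \<comment> \<open>The trace of \<open>e P\<close> is a natural number; taking the integer part recovers it.\<close>
  define m where "m P = nat \<lfloor>Re (mult_trace (e P))\<rfloor>" for P
  have m: "m P > 0 \<and> mult_trace (e P) = of_nat (m P)" if P: "P \<in> V" for P
  proof -
    obtain k :: nat where "k > 0" "mult_trace (e P) = of_nat k"
      using mult_trace_indicator[OF P e[OF P]] by blast
    then show ?thesis by (simp add: m_def)
  qed
  have "mult_trace f = (\<Sum>P\<in>V. of_nat (m P) * eval_zw P f)" for f
  proof -
    have "mult_trace f = mult_trace (\<Sum>P\<in>V. const_poly (eval_zw P f) * e P)"
    proof (rule mult_trace_eq_if_values_eq)
      fix Q assume "Q \<in> V"
      then have "(\<Sum>P\<in>V. eval_zw P f * eval_zw Q (e P)) = (\<Sum>P\<in>V. if P = Q then eval_zw P f else 0)"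
        using e by (intro sum.cong) auto
      then show "eval_zw Q f = eval_zw Q (\<Sum>P\<in>V. const_poly (eval_zw P f) * e P)"
        using \<open>Q \<in> V\<close> finite_zero_set by simp
    qed
    also have "\<dots> = (\<Sum>P\<in>V. eval_zw P f * mult_trace (e P))" by (rule mult_trace_linear_combination)
    also have "\<dots> = (\<Sum>P\<in>V. of_nat (m P) * eval_zw P f)"
      using m by (intro sum.cong) (simp_all add: mult.commute)
    finally show ?thesis .
  qed
  with m show ?thesis by (intro exI[of _ m]) simp
qed

end

locale star_invariant_zero_dim_ideal = zero_dim_ideal I bs
  for I :: "'r::finite zw_poly set" and bs :: "'r zw_poly list" +
  assumes star_invariant: "f \<in> I \<Longrightarrow> star f \<in> I"
begin

lemma star_mem_iff [simp]: "star f \<in> I \<longleftrightarrow> f \<in> I"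
  using star_invariant[of f] star_invariant[of "star f"] by auto

lemma conj_point_zero_set [simp]: "conj_point P \<in> V \<longleftrightarrow> P \<in> V"
proof -
  have "conj_point P \<in> V" if "P \<in> V" for P
    unfolding zero_set_def
  proof (intro CollectI ballI)
    fix f assume "f \<in> I"
    then have "eval_zw P (star f) = 0" using that star_invariant unfolding zero_set_def by blast
    then show "eval_zw (conj_point P) f = 0" by (simp add: eval_zw_star)
  qed
  from this[of P] this[of "conj_point P"] show ?thesis by auto
qed

lemma star_sum: "star (\<Sum>i<n. const_poly (a i) * f i) = (\<Sum>i<n. const_poly (cnj (a i)) * star (f i))"
  for n :: nat
  by (induction n) (simp_all add: star_add star_mult star_const)

lemma star_diff: "star (f - g) = star f - star g"
  using star_add[of "f - g" g] by (simp add: algebra_simps)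

text \<open>
  The involution is a conjugate-linear bijection of the quotient, so it maps bases to bases.
\<close>

lemma star_basis: "quotient_basis I (map star bs)"
proof -
  have ex1: "\<exists>!a. a \<in> carrier_vec (length bs) \<and> u - lincomb_list scale_poly (map star bs) a \<in> I" for u
  proof -
    \<comment> \<open>Applying \<open>star\<close> turns a representation in one family into one in the other, with conjugated coordinates.\<close>
    have mem: "u - lincomb_list scale_poly (map star bs) a \<in> I
        \<longleftrightarrow> star u - lincomb_list scale_poly bs (conjugate a) \<in> I" if "a \<in> carrier_vec (length bs)" for a
    proof -
      have "star (u - lincomb_list scale_poly (map star bs) a) = star u - lincomb_list scale_poly bs (conjugate a)"
        using that by (simp add: lincomb_list_def star_diff star_sum)
      then show ?thesis by (metis star_mem_iff)
    qed
    obtain a where a: "a \<in> carrier_vec (length bs)" "star u - lincomb_list scale_poly bs a \<in> I"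
      and uniq: "\<And>b. b \<in> carrier_vec (length bs) \<Longrightarrow> star u - lincomb_list scale_poly bs b \<in> I \<Longrightarrow> b = a"
      using basis unfolding basis_mod_def by (metis UNIV_I)
    show ?thesis
    proof (intro ex1I[of _ "conjugate a"])
      show "conjugate a \<in> carrier_vec (length bs) \<and> u - lincomb_list scale_poly (map star bs) (conjugate a) \<in> I"
        using a mem[of "conjugate a"] by simp
      fix b assume b: "b \<in> carrier_vec (length bs) \<and> u - lincomb_list scale_poly (map star bs) b \<in> I"
      then have "conjugate b = a" using mem[of b] by (intro uniq) auto
      then show "b = conjugate a" by auto
    qed
  qed
  then show ?thesis by (simp add: basis_mod_def)
qed

lemma coord_star_basis:
  assumes "i < length bs"
  shows "coord (map star bs) i (star u) = cnj (coord bs i u)"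
proof -
  have "star (u - (\<Sum>i<length bs. const_poly (coord bs i u) * bs ! i)) \<in> I"
    using coord_expansion[OF basis, of u] by simp
  then have "star u - (\<Sum>i<length bs. const_poly (cnj (coord bs i u)) * star (bs ! i)) \<in> I"
    by (simp only: star_diff star_sum)
  then show ?thesis
    using assms by (intro coord_eqI[OF star_basis]) simp_all
qed

text \<open>
  In the image of the basis under \<open>star\<close>, the matrix of multiplication by \<open>star f\<close> is the conjugate of
  the matrix of multiplication by \<open>f\<close>.
\<close>

lemma mult_trace_star: "mult_trace (star f) = cnj (mult_trace f)"
proof -
  have "mult_trace (star f) = (\<Sum>i<length (map star bs). coord (map star bs) i (map star bs ! i * star f))"
    unfolding mult_trace_def
    by (rule trace_basis_independent[OF basis star_basis, of "\<lambda>u. u * star f"])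
       (simp_all add: distrib_right mult.assoc is_ideal_mult_right[OF ideal])
  also have "\<dots> = (\<Sum>i<length bs. coord (map star bs) i (star (bs ! i * f)))"
    by (simp add: star_mult)
  also have "\<dots> = cnj (mult_trace f)" by (simp add: coord_star_basis mult_trace_def)
  finally show ?thesis .
qed

text \<open>
  The weight at \<open>P\<^sup>*\<close> is the trace of \<open>e\<^sub>P\<^sup>*\<close>, where \<open>e\<^sub>P\<close> is the indicator polynomial of \<open>P\<close>; so it is the
  conjugate of the weight at \<open>P\<close>, and weights are real.
\<close>

theorem symmetric_trace_formula:
  "\<exists>m::'r point \<Rightarrow> nat. (\<forall>P\<in>V. m P > 0 \<and> m (conj_point P) = m P) \<and>
     (\<forall>f. mult_trace f = (\<Sum>P\<in>V. of_nat (m P) * eval_zw P f))"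
proof -
  obtain m :: "'r point \<Rightarrow> nat" where m: "\<And>P. P \<in> V \<Longrightarrow> m P > 0"
    and mult_trace: "\<And>f. mult_trace f = (\<Sum>P\<in>V. of_nat (m P) * eval_zw P f)" using trace_formula by blast
  obtain e where e: "\<And>P Q. P \<in> V \<Longrightarrow> Q \<in> V \<Longrightarrow> eval_zw Q (e P) = (if P = Q then 1 else 0)"
    using interpolation_polys_exist[OF finite_zero_set] by blast
  have mult_trace_e: "mult_trace (e P) = of_nat (m P)" if "P \<in> V" for P
  proof -
    have "mult_trace (e P) = (\<Sum>Q\<in>V. if P = Q then of_nat (m Q) else 0)"
      unfolding mult_trace using e that by (intro sum.cong) auto
    then show ?thesis using that finite_zero_set by simp
  qed
  have sym: "m (conj_point P) = m P" if P: "P \<in> V" for P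
  proof -
    have "mult_trace (e (conj_point P)) = mult_trace (star (e P))"
    proof (rule mult_trace_eq_if_values_eq)
      fix Q assume "Q \<in> V"
      have "conj_point P = Q \<longleftrightarrow> P = conj_point Q" by auto
      then show "eval_zw Q (e (conj_point P)) = eval_zw Q (star (e P))"
        using e[of "conj_point P" Q] e[of P "conj_point Q"] P \<open>Q \<in> V\<close> by (simp add: eval_zw_star)
    qed
    then have "(of_nat (m (conj_point P)) :: complex) = cnj (of_nat (m P))"
      using P by (simp add: mult_trace_e mult_trace_star)
    then show ?thesis by (simp only: complex_cnj_of_nat of_nat_eq_iff)
  qed
  show ?thesis by (intro exI[of _ m] conjI ballI allI m sym mult_trace)
qed

end

section \<open>Diagonalizing the Hermitian Killing form\<close>

text \<open>
  A set that contains exactly one point of each pair \<open>P \<noteq> P\<^sup>*\<close>.  The choice operator is applied to the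
  unordered pair, so it gives the same answer for both points.
\<close>

definition pair_representatives :: "'r point set" where
  "pair_representatives = {P. conj_point P \<noteq> P \<and> (SOME Q. Q \<in> {P, conj_point P}) = P}"

lemma pair_representatives_exclusive:
  assumes "conj_point P \<noteq> P"
  shows "conj_point P \<in> pair_representatives \<longleftrightarrow> P \<notin> pair_representatives"
proof -
  have swap: "{conj_point P, conj_point (conj_point P)} = {P, conj_point P}" by auto
  have "(SOME Q. Q \<in> {P, conj_point P}) \<in> {P, conj_point P}"
    by (rule someI[of _ P]) simp
  then show ?thesis
    using assms unfolding pair_representatives_def mem_Collect_eq swap by auto
qed

context star_invariant_zero_dim_ideal
begin

lemma killing_form_eq_mult_trace: "killing_form I \<xi> f g = mult_trace (star g * f * \<xi>)"
proof -
  define cs where "cs = (SOME bs. quotient_basis I bs)"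
  have cs: "quotient_basis I cs"
    unfolding cs_def by (rule someI[of _ bs]) (rule basis)
  have "killing_form I \<xi> f g = (\<Sum>i<length cs. coord cs i (cs ! i * (star g * f * \<xi>)))"
    by (simp add: killing_form_def quotient_trace_def mat_trace_def quotient_matrix_def mult_map_def
        mult.assoc flip: cs_def)
  also have "\<dots> = mult_trace (star g * f * \<xi>)"
    unfolding mult_trace_def
    by (rule trace_basis_independent[OF cs basis, of "\<lambda>u. u * (star g * f * \<xi>)"])
       (simp_all add: distrib_right mult.assoc is_ideal_mult_right[OF ideal])
  finally show ?thesis .
qed

text \<open>
  The coefficients \<open>m(P)\<close> of the trace formula.
\<close>

definition weight :: "'r point \<Rightarrow> nat" where
  "weight = (SOME m. (\<forall>P\<in>V. m P > 0 \<and> m (conj_point P) = m P) \<and>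
     (\<forall>f. mult_trace f = (\<Sum>P\<in>V. of_nat (m P) * eval_zw P f)))"

lemma weight_pos: "P \<in> V \<Longrightarrow> weight P > 0"
  and weight_conj_point: "P \<in> V \<Longrightarrow> weight (conj_point P) = weight P"
  and mult_trace_eq: "mult_trace f = (\<Sum>P\<in>V. of_nat (weight P) * eval_zw P f)"
  using someI_ex[OF symmetric_trace_formula, folded weight_def] by auto

lemma killing_form_eq_sum:
  "killing_form I \<xi> f g
     = (\<Sum>P\<in>V. of_nat (weight P) * eval_zw P \<xi> * eval_zw P f * cnj (eval_zw (conj_point P) g))"
  unfolding killing_form_eq_mult_trace mult_trace_eq by (simp add: eval_zw_star mult_ac)

lemma sum_zero_set_conj_point: "(\<Sum>P\<in>V. F (conj_point P)) = (\<Sum>P\<in>V. F P)"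
  by (rule sum.reindex_bij_witness[of _ conj_point conj_point]) auto

text \<open>
  A sum over \<open>V\<close> may be compared pair by pair; a fixed point of the involution is counted twice on both
  sides.
\<close>

lemma sum_zero_set_eqI:
  fixes F G :: "'r point \<Rightarrow> complex"
  assumes "\<And>P. P \<in> V \<Longrightarrow> F P + F (conj_point P) = G P + G (conj_point P)"
  shows "(\<Sum>P\<in>V. F P) = (\<Sum>P\<in>V. G P)"
proof -
  have "(\<Sum>P\<in>V. F P + F (conj_point P)) = (\<Sum>P\<in>V. G P + G (conj_point P))"
    using assms by (intro sum.cong) auto
  then show ?thesis by (simp add: sum.distrib sum_zero_set_conj_point)
qed

end

locale hermitian_killing_form = star_invariant_zero_dim_ideal I bs
  for I :: "'r::finite zw_poly set" and bs :: "'r zw_poly list" +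
  fixes \<xi> :: "'r zw_poly"
  assumes star_\<xi>: "star \<xi> = \<xi>"
begin

definition weighted_value :: "'r point \<Rightarrow> complex" where
  "weighted_value P = of_nat (weight P) * eval_zw P \<xi>"

text \<open>
  The coefficients and functionals of a diagonalization indexed by \<open>V\<close>.  A pair \<open>P, P\<^sup>*\<close> with value
  \<open>a \<noteq> 0\<close> at its representative \<open>P\<close> gets the two functionals \<open>a f(P) \<plusminus> f(P\<^sup>*)\<close>, the one with the plus
  sign being attached to \<open>P\<close>.
\<close>

definition diag_coeff :: "'r point \<Rightarrow> real" where
  "diag_coeff P = (if conj_point P = P then Re (weighted_value P) else if weighted_value P = 0 then 0
          else if P \<in> pair_representatives then 1 / 2 else - 1 / 2)"

definition diag_functional :: "'r point \<Rightarrow> 'r zw_poly \<Rightarrow> complex" where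
  "diag_functional P f = (if conj_point P = P \<or> weighted_value P = 0 then eval_zw P f
            else if P \<in> pair_representatives then weighted_value P * eval_zw P f + eval_zw (conj_point P) f
            else weighted_value (conj_point P) * eval_zw (conj_point P) f - eval_zw P f)"

lemma eval_\<xi>_conj_point: "eval_zw (conj_point P) \<xi> = cnj (eval_zw P \<xi>)"
  using eval_zw_star[of P \<xi>] star_\<xi> by simp

lemma weighted_value_conj_point: "P \<in> V \<Longrightarrow> weighted_value (conj_point P) = cnj (weighted_value P)"
  by (simp add: weighted_value_def weight_conj_point eval_\<xi>_conj_point)

lemma weighted_value_eq_0_iff: "P \<in> V \<Longrightarrow> weighted_value P = 0 \<longleftrightarrow> eval_zw P \<xi> = 0"
  using weight_pos[of P] by (simp add: weighted_value_def)

text \<open>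
  On a pair, with \<open>u = f(P)\<close>, \<open>v = f(P\<^sup>*)\<close>, \<open>u' = g(P)\<close>, \<open>v' = g(P\<^sup>*)\<close>, this is the polarization identity
  \<open>a u cnj v' + cnj a v cnj u' = ((a u + v) cnj (a u' + v') - (a u - v) cnj (a u' - v')) / 2\<close>.
\<close>

lemma killing_form_decomposition:
  "killing_form I \<xi> f g = (\<Sum>P\<in>V. of_real (diag_coeff P) * diag_functional P f * cnj (diag_functional P g))"
proof -
  let ?F = "\<lambda>P. weighted_value P * eval_zw P f * cnj (eval_zw (conj_point P) g)"
  let ?G = "\<lambda>P. of_real (diag_coeff P) * diag_functional P f * cnj (diag_functional P g)"
  have rep: "?F P + ?F (conj_point P) = ?G P + ?G (conj_point P)"
    if P: "P \<in> V" and R: "P \<in> pair_representatives" for P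
  proof (cases "weighted_value P = 0")
    case True
    then show ?thesis using R P by (simp add: diag_coeff_def pair_representatives_def weighted_value_conj_point)
  next
    case False
    have ne: "conj_point P \<noteq> P" using R by (simp add: pair_representatives_def)
    then have "conj_point P \<notin> pair_representatives"
      using R by (simp add: pair_representatives_exclusive)
    then show ?thesis
      using False R P ne by (simp add: diag_coeff_def diag_functional_def weighted_value_conj_point) (simp add: field_simps)
  qed
  have "?F P + ?F (conj_point P) = ?G P + ?G (conj_point P)" if P: "P \<in> V" for P
  proof (cases "conj_point P = P")
    case True
    then have "cnj (weighted_value P) = weighted_value P" using weighted_value_conj_point[OF P] by simp
    then have "of_real (Re (weighted_value P)) = weighted_value P" by (metis Reals_cnj_iff of_real_Re)
    then show ?thesis using True by (simp add: diag_coeff_def diag_functional_def)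
  next
    case False
    then consider "P \<in> pair_representatives" | "conj_point P \<in> pair_representatives"
      using pair_representatives_exclusive by blast
    then show ?thesis
    proof cases
      case 1
      then show ?thesis by (rule rep[OF P])
    next
      case 2
      then show ?thesis using rep[of "conj_point P"] P by (simp add: add.commute)
    qed
  qed
  then have "(\<Sum>P\<in>V. ?F P) = (\<Sum>P\<in>V. ?G P)" by (rule sum_zero_set_eqI)
  then show ?thesis by (simp add: killing_form_eq_sum weighted_value_def)
qed

lemma diag_functional_expansion: "P \<in> V \<Longrightarrow> (\<Sum>i<length bs. diag_functional P (bs ! i) * coord bs i u) = diag_functional P u"
  using eval_expansion[of P u] eval_expansion[of "conj_point P" u]
  by (simp add: diag_functional_def algebra_simps sum.distrib sum_subtractf sum_distrib_left)

text \<open>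
  The dual vectors are combinations of the interpolation polynomials of the two points of a pair.
\<close>

lemma diag_functional_dual_family: "\<exists>w. \<forall>P\<in>V. \<forall>Q\<in>V. diag_functional P (w Q) = (if P = Q then 1 else 0)"
proof -
  obtain e where e: "\<And>P Q. P \<in> V \<Longrightarrow> Q \<in> V \<Longrightarrow> eval_zw Q (e P) = (if P = Q then 1 else 0)"
    using interpolation_polys_exist[OF finite_zero_set] by blast
  define w where "w Q = (if conj_point Q = Q \<or> weighted_value Q = 0 then e Q
      else if Q \<in> pair_representatives
        then const_poly (1 / 2) * (const_poly (1 / weighted_value Q) * e Q + e (conj_point Q))
        else const_poly (1 / 2) * (const_poly (1 / weighted_value (conj_point Q)) * e (conj_point Q) - e Q))" for Q
  have "diag_functional P (w Q) = (if P = Q then 1 else 0)" if P: "P \<in> V" and Q: "Q \<in> V" for P Q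
  proof -
    have PQ: "conj_point P \<in> V" "conj_point Q \<in> V" using P Q by simp_all
    note ev = e[OF Q P] e[OF Q PQ(1)] e[OF PQ(2) P] e[OF PQ(2) PQ(1)]
    consider "P = Q" | "P \<noteq> Q" "P = conj_point Q" | "P \<noteq> Q" "P \<noteq> conj_point Q" by blast
    then show ?thesis
    proof cases
      case 1
      then show ?thesis
        using ev P weighted_value_conj_point[OF P] by (auto simp: diag_functional_def w_def field_simps)
    next
      case 2
      then have "conj_point Q \<in> pair_representatives \<longleftrightarrow> Q \<notin> pair_representatives"
        by (intro pair_representatives_exclusive) simp
      then show ?thesis
        using 2 ev Q weighted_value_conj_point[OF Q] by (auto simp: diag_functional_def w_def field_simps)
    next
      case 3
      then have "conj_point P \<noteq> Q" "conj_point P \<noteq> conj_point Q"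
        by (metis conj_point_conj_point)+
      then show ?thesis using 3 ev by (auto simp: diag_functional_def w_def)
    qed
  qed
  then show ?thesis by blast
qed

lemma killing_form_diagonalization:
  "\<exists>v. hermitian_diagonalization (length bs) (\<lambda>i j. killing_form I \<xi> (bs ! i) (bs ! j)) V diag_coeff (\<lambda>P i. diag_functional P (bs ! i)) v"
proof -
  obtain w where w: "\<forall>P\<in>V. \<forall>Q\<in>V. diag_functional P (w Q) = (if P = Q then 1 else 0)"
    using diag_functional_dual_family by blast
  show ?thesis
    unfolding hermitian_diagonalization_def
    using w finite_zero_set
    by (intro exI[of _ "\<lambda>Q i. coord bs i (w Q)"]) (simp add: killing_form_decomposition diag_functional_expansion)
qed

lemma diag_coeff_pos_iff:
  assumes "P \<in> V"
  shows "diag_coeff P > 0 \<longleftrightarrow> conjugated_single P \<and> 0 < eval_zw P \<xi> \<or> P \<in> pair_representatives \<and> eval_zw P \<xi> \<noteq> 0"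
proof (cases "conj_point P = P")
  case True
  then have "Im (eval_zw P \<xi>) = 0" using eval_\<xi>_conj_point[of P] by (simp add: complex_eq_iff)
  then show ?thesis
    using True weight_pos[OF assms]
    by (simp add: diag_coeff_def weighted_value_def conjugated_single_iff pair_representatives_def less_complex_def zero_less_mult_iff)
next
  case False
  then show ?thesis using assms by (simp add: diag_coeff_def weighted_value_eq_0_iff conjugated_single_iff)
qed

lemma diag_coeff_neg_iff:
  assumes "P \<in> V"
  shows "diag_coeff P < 0 \<longleftrightarrow> conjugated_single P \<and> eval_zw P \<xi> < 0
    \<or> conj_point P \<in> pair_representatives \<and> eval_zw P \<xi> \<noteq> 0"
proof (cases "conj_point P = P")
  case True
  then have "Im (eval_zw P \<xi>) = 0" using eval_\<xi>_conj_point[of P] by (simp add: complex_eq_iff)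
  then show ?thesis
    using True weight_pos[OF assms]
    by (simp add: diag_coeff_def weighted_value_def conjugated_single_iff pair_representatives_def less_complex_def mult_less_0_iff)
next
  case False
  then show ?thesis
    using assms pair_representatives_exclusive[OF False] by (simp add: diag_coeff_def weighted_value_eq_0_iff conjugated_single_iff)
qed

lemma diag_coeff_eq_0_iff:
  assumes "P \<in> V"
  shows "diag_coeff P = 0 \<longleftrightarrow> eval_zw P \<xi> = 0"
proof (cases "conj_point P = P")
  case True
  then have "Im (eval_zw P \<xi>) = 0" using eval_\<xi>_conj_point[of P] by (simp add: complex_eq_iff)
  then show ?thesis using True weight_pos[OF assms] by (simp add: diag_coeff_def weighted_value_def complex_eq_iff)
next
  case False
  then show ?thesis using assms by (simp add: diag_coeff_def weighted_value_eq_0_iff)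
qed

text \<open>
  The two points of a pair on which \<open>\<xi>\<close> does not vanish carry one positive and one negative coefficient;
  hence such pairs, counted by their representatives, occur in both indices.
\<close>

theorem killing_form_inertia:
  shows "form_rank bs (killing_form I \<xi>) = card {P \<in> V. eval_zw P \<xi> \<noteq> 0}"
    and "num_pos_eigenvalues bs (killing_form I \<xi>)
      = card {P \<in> V. conjugated_single P \<and> 0 < eval_zw P \<xi>}
        + card {P \<in> V. P \<in> pair_representatives \<and> eval_zw P \<xi> \<noteq> 0}"
    and "num_neg_eigenvalues bs (killing_form I \<xi>)
      = card {P \<in> V. conjugated_single P \<and> eval_zw P \<xi> < 0}
        + card {P \<in> V. P \<in> pair_representatives \<and> eval_zw P \<xi> \<noteq> 0}"
proof -
  obtain v where D: "hermitian_diagonalization (length bs)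
      (\<lambda>i j. killing_form I \<xi> (bs ! i) (bs ! j)) V diag_coeff (\<lambda>P i. diag_functional P (bs ! i)) v"
    using killing_form_diagonalization by blast
  note inertia = inertia_of_diagonalization[OF D, folded form_matrix_def]
  have not_single: "conj_point P \<in> pair_representatives \<Longrightarrow> \<not> conjugated_single P"
    "P \<in> pair_representatives \<Longrightarrow> \<not> conjugated_single P" for P
    by (auto simp: pair_representatives_def conjugated_single_iff)
  show "form_rank bs (killing_form I \<xi>) = card {P \<in> V. eval_zw P \<xi> \<noteq> 0}"
    unfolding form_rank_def inertia(1) by (intro arg_cong[of _ _ card]) (auto simp: diag_coeff_eq_0_iff)
  have "num_pos_eigenvalues bs (killing_form I \<xi>) = card {P \<in> V. 0 < diag_coeff P}"
    unfolding num_pos_eigenvalues_def by (rule inertia(2))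
  also have "{P \<in> V. 0 < diag_coeff P} = {P \<in> V. conjugated_single P \<and> 0 < eval_zw P \<xi>}
      \<union> {P \<in> V. P \<in> pair_representatives \<and> eval_zw P \<xi> \<noteq> 0}"
    by (auto simp: diag_coeff_pos_iff)
  also have "card \<dots> = card {P \<in> V. conjugated_single P \<and> 0 < eval_zw P \<xi>}
      + card {P \<in> V. P \<in> pair_representatives \<and> eval_zw P \<xi> \<noteq> 0}"
    using finite_zero_set not_single by (intro card_Un_disjoint) auto
  finally show "num_pos_eigenvalues bs (killing_form I \<xi>)
      = card {P \<in> V. conjugated_single P \<and> 0 < eval_zw P \<xi>}
        + card {P \<in> V. P \<in> pair_representatives \<and> eval_zw P \<xi> \<noteq> 0}" .
  have "num_neg_eigenvalues bs (killing_form I \<xi>) = card {P \<in> V. diag_coeff P < 0}"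
    unfolding num_neg_eigenvalues_def by (rule inertia(3))
  also have "{P \<in> V. diag_coeff P < 0} = {P \<in> V. conjugated_single P \<and> eval_zw P \<xi> < 0}
      \<union> {P \<in> V. conj_point P \<in> pair_representatives \<and> eval_zw P \<xi> \<noteq> 0}"
    by (auto simp: diag_coeff_neg_iff)
  also have "card \<dots> = card {P \<in> V. conjugated_single P \<and> eval_zw P \<xi> < 0}
      + card {P \<in> V. conj_point P \<in> pair_representatives \<and> eval_zw P \<xi> \<noteq> 0}"
    using finite_zero_set not_single by (intro card_Un_disjoint) auto
  also have "card {P \<in> V. conj_point P \<in> pair_representatives \<and> eval_zw P \<xi> \<noteq> 0}
      = card {P \<in> V. P \<in> pair_representatives \<and> eval_zw P \<xi> \<noteq> 0}"
    by (intro bij_betw_same_card[of conj_point] bij_betwI[of _ _ _ conj_point])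
       (auto simp: eval_\<xi>_conj_point)
  finally show "num_neg_eigenvalues bs (killing_form I \<xi>)
      = card {P \<in> V. conjugated_single P \<and> eval_zw P \<xi> < 0}
        + card {P \<in> V. P \<in> pair_representatives \<and> eval_zw P \<xi> \<noteq> 0}" .
qed

text \<open>
  Testing the form on the interpolation polynomial of \<open>P\<close> gives \<open>m(P) \<xi>(P)\<close> if \<open>P = P\<^sup>*\<close> and \<open>0\<close> otherwise;
  testing it on a polynomial that vanishes on \<open>V\<close> gives \<open>0\<close>.
\<close>

lemma positive_definite_iff:
  "positive_definite_mod I (killing_form I \<xi>) \<longleftrightarrow>
     (\<forall>P\<in>V. conjugated_single P \<and> 0 < eval_zw P \<xi>) \<and> (\<forall>f. (\<forall>P\<in>V. eval_zw P f = 0) \<longrightarrow> f \<in> I)"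
proof (intro iffI conjI ballI allI impI)
  assume pd: "positive_definite_mod I (killing_form I \<xi>)"
  fix P assume P: "P \<in> V"
  obtain e where e: "\<And>Q. Q \<in> V \<Longrightarrow> eval_zw Q e = (if P = Q then 1 else 0)"
    using interpolation_polys_exist[OF finite_zero_set] P by blast
  have "e \<notin> I" using e[OF P] P unfolding zero_set_def by auto
  with pd have "0 < killing_form I \<xi> e e" by (simp add: positive_definite_mod_def)
  also have "killing_form I \<xi> e e = (\<Sum>Q\<in>V. if P = Q then of_nat (weight P) * eval_zw P \<xi> * cnj (eval_zw (conj_point P) e) else 0)"
    unfolding killing_form_eq_sum using e by (intro sum.cong) auto
  also have "\<dots> = of_nat (weight P) * eval_zw P \<xi> * (if P = conj_point P then 1 else 0)"
    using P finite_zero_set e[of "conj_point P"] by simp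
  finally have pos: "0 < of_nat (weight P) * eval_zw P \<xi> * (if P = conj_point P then 1 else 0)" .
  then have "P = conj_point P" by (metis less_irrefl mult_zero_right)
  then show "conjugated_single P" by (simp add: conjugated_single_iff)
  show "0 < eval_zw P \<xi>"
    using pos \<open>P = conj_point P\<close> weight_pos[OF P] by (simp add: less_complex_def zero_less_mult_iff)
next
  assume pd: "positive_definite_mod I (killing_form I \<xi>)"
  fix f assume "\<forall>P\<in>V. eval_zw P f = 0"
  then have "killing_form I \<xi> f f = 0" by (simp add: killing_form_eq_sum)
  then show "f \<in> I" using pd by (auto simp: positive_definite_mod_def)
next
  assume *: "(\<forall>P\<in>V. conjugated_single P \<and> 0 < eval_zw P \<xi>) \<and> (\<forall>f. (\<forall>P\<in>V. eval_zw P f = 0) \<longrightarrow> f \<in> I)"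
  show "positive_definite_mod I (killing_form I \<xi>)"
    unfolding positive_definite_mod_def
  proof (intro allI impI)
    fix f assume "f \<notin> I"
    with * obtain P where P: "P \<in> V" "eval_zw P f \<noteq> 0" by blast
    let ?r = "\<lambda>Q. real (weight Q) * Re (eval_zw Q \<xi>) * (cmod (eval_zw Q f))\<^sup>2"
    have "killing_form I \<xi> f f = (\<Sum>Q\<in>V. of_real (?r Q))"
      unfolding killing_form_eq_sum
    proof (intro sum.cong refl)
      fix Q assume "Q \<in> V"
      with * have "conj_point Q = Q" "eval_zw Q \<xi> = of_real (Re (eval_zw Q \<xi>))"
        by (auto simp: conjugated_single_iff less_complex_def complex_eq_iff)
      then show "of_nat (weight Q) * eval_zw Q \<xi> * eval_zw Q f * cnj (eval_zw (conj_point Q) f) = of_real (?r Q)"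
        by (metis (no_types, lifting) complex_norm_square mult.assoc of_real_mult of_real_of_nat_eq)
    qed
    also have "\<dots> = of_real (\<Sum>Q\<in>V. ?r Q)" by simp
    finally have K: "killing_form I \<xi> f f = of_real (\<Sum>Q\<in>V. ?r Q)" .
    have pos: "Re (eval_zw Q \<xi>) > 0" "weight Q > 0" if "Q \<in> V" for Q
      using * that weight_pos by (auto simp: less_complex_def)
    have "0 < ?r P" using pos[OF P(1)] P(2) by simp
    moreover have "0 \<le> ?r Q" if "Q \<in> V" for Q using pos[OF that] by simp
    ultimately have "0 < (\<Sum>Q\<in>V. ?r Q)"
      using finite_zero_set P(1) by (intro sum_pos2[of _ P])
    then show "0 < killing_form I \<xi> f f" unfolding K by (simp add: less_complex_def)
  qed
qed

end

section \<open>Local multiplicities\<close>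

abbreviation scale_fract :: "complex \<Rightarrow> 'r::{finite,linorder} zw_poly fract \<Rightarrow> 'r zw_poly fract" where
  "scale_fract a q \<equiv> Fraction_Field.Fract (const_poly a) 1 * q"

lemma vector_space_scale_fract:
  "vector_space (scale_fract :: complex \<Rightarrow> 'r::{finite,linorder} zw_poly fract \<Rightarrow> 'r zw_poly fract)"
proof unfold_locales
  fix a b :: complex and x y :: "'r zw_poly fract"
  have "Fraction_Field.Fract (const_poly (a + b)) 1
      = Fraction_Field.Fract (const_poly a) 1 + Fraction_Field.Fract (const_poly b :: 'r zw_poly) 1"
    by (simp add: const_poly_add)
  then show "scale_fract (a + b) x = scale_fract a x + scale_fract b x"
    by (simp only: distrib_right)
  have "Fraction_Field.Fract (const_poly (a * b)) 1
      = Fraction_Field.Fract (const_poly a) 1 * Fraction_Field.Fract (const_poly b :: 'r zw_poly) 1"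
    by (simp add: const_poly_mult)
  then show "scale_fract a (scale_fract b x) = scale_fract (a * b) x"
    by (simp only: mult.assoc)
qed (simp_all add: distrib_left flip: One_fract_def)

lemma eval_nonzero_imp_nonzero: "eval_zw P g \<noteq> 0 \<Longrightarrow> g \<noteq> 0"
  by auto

context
  fixes I :: "'r::{finite,linorder} zw_poly set" and P :: "'r point"
  assumes ideal: "is_ideal I"
begin

text \<open>
  Membership in the local ideal is reduced to the polynomial ring: denominators and the factor \<open>s\<close> are
  units at \<open>P\<close>.
\<close>

lemma Fract_in_local_ideal_iff:
  assumes g: "eval_zw P g \<noteq> 0"
  shows "Fraction_Field.Fract f g \<in> local_ideal I P \<longleftrightarrow> (\<exists>s. eval_zw P s \<noteq> 0 \<and> s * f \<in> I)"
proof
  assume "Fraction_Field.Fract f g \<in> local_ideal I P"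
  then obtain f' g' where f': "f' \<in> I" and g': "eval_zw P g' \<noteq> 0"
    and eq: "Fraction_Field.Fract f g = Fraction_Field.Fract f' g'"
    unfolding local_ideal_def by blast
  have "f * g' = f' * g"
    using eq g g' by (simp add: eq_fract eval_nonzero_imp_nonzero)
  then have "g' * f = g * f'" by (simp add: mult.commute)
  then have "g' * f \<in> I" using is_ideal_mult[OF ideal f'] by simp
  then show "\<exists>s. eval_zw P s \<noteq> 0 \<and> s * f \<in> I" using g' by blast
next
  assume "\<exists>s. eval_zw P s \<noteq> 0 \<and> s * f \<in> I"
  then obtain s where s: "eval_zw P s \<noteq> 0" "s * f \<in> I" by blast
  have "Fraction_Field.Fract f g = Fraction_Field.Fract (s * f) (s * g)"
    using s(1) by (simp add: mult_fract_cancel eval_nonzero_imp_nonzero)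
  moreover have "eval_zw P (s * g) \<noteq> 0" using s(1) g by simp
  ultimately show "Fraction_Field.Fract f g \<in> local_ideal I P"
    unfolding local_ideal_def using s(2) by blast
qed

lemma quotient_space_local: "quotient_space scale_fract (local_ring P) (local_ideal I P)"
proof (intro quotient_space.intro quotient_space_axioms.intro)
  interpret vector_space "scale_fract :: complex \<Rightarrow> 'r zw_poly fract \<Rightarrow> 'r zw_poly fract"
    by (rule vector_space_scale_fract)
  show "vector_space (scale_fract :: complex \<Rightarrow> 'r zw_poly fract \<Rightarrow> 'r zw_poly fract)"
    by (rule vector_space_scale_fract)
  show "subspace (local_ring P)"
    unfolding subspace_def
  proof (intro conjI ballI allI)
    show "0 \<in> local_ring P"
      unfolding local_ring_def Zero_fract_def by (intro CollectI exI[of _ 0] exI[of _ 1]) simp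
    fix x y assume "x \<in> local_ring P" "y \<in> local_ring P"
    then obtain f g f' g' where "x = Fraction_Field.Fract f g" "eval_zw P g \<noteq> 0"
      "y = Fraction_Field.Fract f' g'" "eval_zw P g' \<noteq> 0"
      unfolding local_ring_def by blast
    then have "x + y = Fraction_Field.Fract (f * g' + f' * g) (g * g')" "eval_zw P (g * g') \<noteq> 0"
      by (simp_all add: eval_nonzero_imp_nonzero)
    then show "x + y \<in> local_ring P" unfolding local_ring_def by blast
  next
    fix a x assume "x \<in> local_ring P"
    then obtain f g where "x = Fraction_Field.Fract f g" "eval_zw P g \<noteq> 0"
      unfolding local_ring_def by blast
    then have "scale_fract a x = Fraction_Field.Fract (const_poly a * f) g" "eval_zw P g \<noteq> 0" by simp_all
    then show "scale_fract a x \<in> local_ring P" unfolding local_ring_def by blast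
  qed
  show "subspace (local_ideal I P)"
    unfolding subspace_def
  proof (intro conjI ballI allI)
    show "0 \<in> local_ideal I P"
      unfolding local_ideal_def Zero_fract_def
      using is_ideal_0[OF ideal] by (intro CollectI exI[of _ 0] exI[of _ 1]) simp
    fix x y assume "x \<in> local_ideal I P" "y \<in> local_ideal I P"
    then obtain f g f' g' where x: "x = Fraction_Field.Fract f g" "eval_zw P g \<noteq> 0" "f \<in> I"
      and y: "y = Fraction_Field.Fract f' g'" "eval_zw P g' \<noteq> 0" "f' \<in> I"
      unfolding local_ideal_def by blast
    have "f * g' + f' * g \<in> I"
      using x y by (intro is_ideal_add[OF ideal] is_ideal_mult_right[OF ideal])
    moreover have "x + y = Fraction_Field.Fract (f * g' + f' * g) (g * g')" "eval_zw P (g * g') \<noteq> 0"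
      using x y by (simp_all add: eval_nonzero_imp_nonzero)
    ultimately show "x + y \<in> local_ideal I P" unfolding local_ideal_def by blast
  next
    fix a x assume "x \<in> local_ideal I P"
    then obtain f g where x: "x = Fraction_Field.Fract f g" "eval_zw P g \<noteq> 0" "f \<in> I"
      unfolding local_ideal_def by blast
    then have "scale_fract a x = Fraction_Field.Fract (const_poly a * f) g" "const_poly a * f \<in> I"
      using is_ideal_mult[OF ideal] by simp_all
    then show "scale_fract a x \<in> local_ideal I P" unfolding local_ideal_def using x by blast
  qed
  show "local_ideal I P \<subseteq> local_ring P" unfolding local_ideal_def local_ring_def by blast
qed

end

text \<open>
  Local rings live in the fraction field of the polynomial ring, whose construction needs an order on
  the variables.
\<close>

locale zero_dim_ideal_local = zero_dim_ideal I bs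
  for I :: "'r::{finite,linorder} zw_poly set" and bs :: "'r zw_poly list"
begin

lemma Fract_1_in_local_ring: "Fraction_Field.Fract h 1 \<in> local_ring P"
  unfolding local_ring_def by (intro CollectI exI[of _ h] exI[of _ 1]) simp

text \<open>
  A product of factors \<open>g - x\<close> lies in \<open>I\<close>.  Splitting off the factors with \<open>x = 0\<close> leaves
  \<open>g\<^sup>k (c + g w) \<in> I\<close> with a constant \<open>c \<noteq> 0\<close>; as \<open>g\<^sup>k\<close> does not vanish at \<open>P\<close>, the polynomial \<open>- w / c\<close> is an
  inverse of \<open>g\<close> locally at \<open>P\<close>.
\<close>

lemma inverse_mod_local_ideal:
  assumes g: "eval_zw P g \<noteq> 0"
  shows "\<exists>h s. eval_zw P s \<noteq> 0 \<and> s * (1 - g * h) \<in> I"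
proof -
  obtain M where M: "(\<Prod>x\<in>#M. g - const_poly x) \<in> I" using annihilating_product by blast
  \<comment> \<open>The exponent \<open>k\<close> counts the factors with \<open>x = 0\<close>, and \<open>c\<close> is the product of the other \<open>- x\<close>.\<close>
  have "\<exists>c w k. c \<noteq> 0 \<and> (\<Prod>x\<in>#N. g - const_poly x) = g ^ k * (const_poly c + g * w)" for N
  proof (induction N)
    case empty
    show ?case by (intro exI[of _ 1] exI[of _ 0]) simp
  next
    case (add x N)
    then obtain c w k where cwk: "c \<noteq> 0" "(\<Prod>x\<in>#N. g - const_poly x) = g ^ k * (const_poly c + g * w)"
      by blast
    show ?case
    proof (cases "x = 0")
      case True
      with cwk have "(\<Prod>x\<in>#add_mset x N. g - const_poly x) = g ^ Suc k * (const_poly c + g * w)" by simp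
      with cwk(1) show ?thesis by blast
    next
      case False
      have "(\<Prod>x\<in>#add_mset x N. g - const_poly x) = g ^ k * ((g - const_poly x) * (const_poly c + g * w))"
        by (simp add: cwk(2) mult.left_commute)
      also have "(g - const_poly x) * (const_poly c + g * w)
          = const_poly (- x * c) + g * (const_poly c + g * w - const_poly x * w)"
        unfolding const_poly_mult const_poly_uminus by (simp add: algebra_simps)
      finally have "(\<Prod>x\<in>#add_mset x N. g - const_poly x)
          = g ^ k * (const_poly (- x * c) + g * (const_poly c + g * w - const_poly x * w))" .
      moreover have "- x * c \<noteq> 0" using False cwk(1) by simp
      ultimately show ?thesis by blast
    qed
  qed
  from this[of M] obtain c w k where c: "c \<noteq> 0"
    and prod: "(\<Prod>x\<in>#M. g - const_poly x) = g ^ k * (const_poly c + g * w)" by blast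
  have "const_poly (1 / c) * const_poly c = 1" using c by (simp flip: const_poly_mult)
  then have "const_poly (1 / c) * (const_poly c + g * w) = 1 - g * (- const_poly (1 / c) * w)"
    by (simp add: distrib_left mult_ac)
  then have "g ^ k * (1 - g * (- const_poly (1 / c) * w)) = const_poly (1 / c) * (g ^ k * (const_poly c + g * w))"
    by (metis mult.left_commute)
  also have "\<dots> \<in> I" using M unfolding prod by (rule is_ideal_mult[OF ideal])
  finally show ?thesis using g by (intro exI[of _ "- const_poly (1 / c) * w"] exI[of _ "g ^ k"]) simp
qed

text \<open>
  Denominators can be inverted modulo the local ideal by polynomials, so a basis of the global quotient
  spans the local one.
\<close>

lemma local_quotient_spanned:
  assumes "u \<in> local_ring P"
  shows "\<exists>a. u - (\<Sum>i<length bs. scale_fract (a i) (Fraction_Field.Fract (bs ! i) 1)) \<in> local_ideal I P"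
proof -
  interpret loc: quotient_space scale_fract "local_ring P" "local_ideal I P"
    by (rule quotient_space_local[OF ideal])
  obtain f g where u: "u = Fraction_Field.Fract f g" and g: "eval_zw P g \<noteq> 0"
    using assms unfolding local_ring_def by blast
  obtain h s where s: "eval_zw P s \<noteq> 0" "s * (1 - g * h) \<in> I"
    using inverse_mod_local_ideal[OF g] by blast
  define a where "a i = coord bs i (f * h)" for i
  have sum: "(\<Sum>i<n. scale_fract (a i) (Fraction_Field.Fract (b i) 1))
      = Fraction_Field.Fract (\<Sum>i<n. const_poly (a i) * b i) 1" for b and n :: nat
    by (induction n) (simp_all add: Zero_fract_def)
  have "u - Fraction_Field.Fract (f * h) 1 = Fraction_Field.Fract (f - f * h * g) g"
    using g by (simp add: u eval_nonzero_imp_nonzero)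
  moreover have "s * (f - f * h * g) \<in> I"
    using is_ideal_mult[OF ideal s(2), of f] by (simp add: algebra_simps)
  ultimately have 1: "u - Fraction_Field.Fract (f * h) 1 \<in> local_ideal I P"
    using Fract_in_local_ideal_iff[OF ideal g] s(1) by auto
  have "f * h - (\<Sum>i<length bs. const_poly (a i) * bs ! i) \<in> I"
    using coord_expansion[OF basis, of "f * h"] by (simp add: a_def)
  then have 2: "Fraction_Field.Fract (f * h - (\<Sum>i<length bs. const_poly (a i) * bs ! i)) 1 \<in> local_ideal I P"
    by (subst Fract_in_local_ideal_iff[OF ideal]) (auto intro!: exI[of _ 1])
  have "u - (\<Sum>i<length bs. scale_fract (a i) (Fraction_Field.Fract (bs ! i) 1))
    = (u - Fraction_Field.Fract (f * h) 1)
      + Fraction_Field.Fract (f * h - (\<Sum>i<length bs. const_poly (a i) * bs ! i)) 1"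
    unfolding sum by (simp flip: diff_fract)
  also have "\<dots> \<in> local_ideal I P" by (rule loc.subspace_add[OF loc.subspace_W 1 2])
  finally show ?thesis by blast
qed

lemma local_basis_exists: "\<exists>ls. basis_mod scale_fract (local_ring P) (local_ideal I P) ls"
proof -
  interpret loc: quotient_space scale_fract "local_ring P" "local_ideal I P"
    by (rule quotient_space_local[OF ideal])
  let ?\<iota> = "\<lambda>i. Fraction_Field.Fract (bs ! i) 1"
  show ?thesis
  proof (rule loc.basis_mod_exists[of "?\<iota> ` {..<length bs}"])
    show "?\<iota> ` {..<length bs} \<subseteq> local_ring P"
      by (simp add: image_subset_iff Fract_1_in_local_ring)
    fix u assume "u \<in> local_ring P"
    from local_quotient_spanned[OF this] obtain a where
      a: "u - (\<Sum>i<length bs. scale_fract (a i) (?\<iota> i)) \<in> local_ideal I P" by blast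
    \<comment> \<open>The coefficients are collected along the fibres of the map from indices to fractions.\<close>
    have "(\<Sum>i<length bs. scale_fract (a i) (?\<iota> i))
        = (\<Sum>b\<in>?\<iota> ` {..<length bs}. \<Sum>i\<in>{i\<in>{..<length bs}. ?\<iota> i = b}. scale_fract (a i) (?\<iota> i))"
      by (rule sum.image_gen) simp
    also have "\<dots> = (\<Sum>b\<in>?\<iota> ` {..<length bs}. scale_fract (\<Sum>i\<in>{i\<in>{..<length bs}. ?\<iota> i = b}. a i) b)"
      by (intro sum.cong refl) (simp only: loc.scale_sum_left, intro sum.cong, auto)
    finally show "\<exists>a. u - (\<Sum>b\<in>?\<iota> ` {..<length bs}. scale_fract (a b) b) \<in> local_ideal I P"
      using a by (intro exI[of _ "\<lambda>b. \<Sum>i\<in>{i\<in>{..<length bs}. ?\<iota> i = b}. a i"]) simp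
  qed simp
qed

text \<open>
  In a one-dimensional local quotient the class of \<open>1\<close>, which is not zero, spans; so \<open>f\<close> is congruent to a
  constant, and that constant is the value of \<open>f\<close> at \<open>P\<close>.
\<close>

lemma local_factor_if_multiplicity_1:
  assumes P: "P \<in> V" and mult: "multiplicity_at I P = 1" and f: "eval_zw P f = 0"
  shows "\<exists>s. eval_zw P s \<noteq> 0 \<and> s * f \<in> I"
proof -
  interpret loc: quotient_space scale_fract "local_ring P" "local_ideal I P"
    by (rule quotient_space_local[OF ideal])
  obtain ls where ls: "basis_mod scale_fract (local_ring P) (local_ideal I P) ls"
    using local_basis_exists by blast
  have len: "length ls = 1" using mult loc.dim_mod_eq_length[OF ls] by (simp add: multiplicity_at_def)
  define b where "b = ls ! 0"
  have "\<exists>\<alpha>. Fraction_Field.Fract h 1 - scale_fract \<alpha> b \<in> local_ideal I P" for h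
    using loc.coord_expansion[OF ls Fract_1_in_local_ring[of h]] len by (auto simp: b_def)
  then obtain \<alpha> \<beta> where \<alpha>: "Fraction_Field.Fract 1 1 - scale_fract \<alpha> b \<in> local_ideal I P"
    and \<beta>: "Fraction_Field.Fract f 1 - scale_fract \<beta> b \<in> local_ideal I P" by blast
  have "\<alpha> \<noteq> 0"
  proof
    assume "\<alpha> = 0"
    then have "Fraction_Field.Fract 1 1 \<in> local_ideal I P"
      using \<alpha> by (simp flip: Zero_fract_def)
    then obtain s where "eval_zw P s \<noteq> 0" "s * 1 \<in> I"
      using Fract_in_local_ideal_iff[OF ideal, of P 1 1] by auto
    then show False using P by (auto simp: zero_set_def)
  qed
  define \<gamma> where "\<gamma> = \<beta> / \<alpha>"
  have "(Fraction_Field.Fract f 1 - scale_fract \<beta> b) - scale_fract \<gamma> (Fraction_Field.Fract 1 1 - scale_fract \<alpha> b) \<in> local_ideal I P"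
    by (rule loc.subspace_diff[OF loc.subspace_W \<beta> loc.subspace_scale[OF loc.subspace_W \<alpha>]])
  also have "scale_fract \<gamma> (Fraction_Field.Fract 1 1 - scale_fract \<alpha> b)
      = Fraction_Field.Fract (const_poly \<gamma>) 1 - scale_fract \<beta> b"
    using \<open>\<alpha> \<noteq> 0\<close> loc.scale_scale[of \<gamma> \<alpha> b]
    by (simp add: \<gamma>_def right_diff_distrib)
  finally have "Fraction_Field.Fract (f - const_poly \<gamma>) 1 \<in> local_ideal I P" by simp
  then obtain s where s: "eval_zw P s \<noteq> 0" "s * (f - const_poly \<gamma>) \<in> I"
    using Fract_in_local_ideal_iff[OF ideal, of P 1] by auto
  have "eval_zw P (s * (f - const_poly \<gamma>)) = 0" using s(2) P unfolding zero_set_def by blast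
  then have "\<gamma> = 0" using s(1) f by simp
  then show ?thesis using s by auto
qed

text \<open>
  A fraction \<open>f/g\<close> is congruent to its value \<open>\<alpha>\<close> at \<open>P\<close>: the product of \<open>f - \<alpha> g\<close> with the interpolation
  polynomial of \<open>P\<close> vanishes on all of \<open>V\<close>, so it lies in \<open>I\<close>.
\<close>

lemma multiplicity_1_if_radical:
  assumes P: "P \<in> V" and radical: "\<And>f. (\<forall>Q\<in>V. eval_zw Q f = 0) \<Longrightarrow> f \<in> I"
  shows "multiplicity_at I P = 1"
proof -
  interpret loc: quotient_space scale_fract "local_ring P" "local_ideal I P"
    by (rule quotient_space_local[OF ideal])
  obtain e where e: "\<And>Q. Q \<in> V \<Longrightarrow> eval_zw Q e = (if P = Q then 1 else 0)"
    using interpolation_polys_exist[OF finite_zero_set] P by blast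
  have lin: "lincomb_list scale_fract [1] v = Fraction_Field.Fract (const_poly (v $ 0)) 1" for v
    by (simp add: lincomb_list_def)
  have ex: "\<exists>\<alpha>. u - Fraction_Field.Fract (const_poly \<alpha>) 1 \<in> local_ideal I P" if "u \<in> local_ring P" for u
  proof -
    from that obtain f g where u: "u = Fraction_Field.Fract f g" and g: "eval_zw P g \<noteq> 0"
      unfolding local_ring_def by blast
    define \<alpha> where "\<alpha> = eval_zw P f / eval_zw P g"
    have "e * (f - const_poly \<alpha> * g) \<in> I"
      using e g by (intro radical) (auto simp: \<alpha>_def)
    then have "\<exists>s. eval_zw P s \<noteq> 0 \<and> s * (f - const_poly \<alpha> * g) \<in> I"
      using e[OF P] by (intro exI[of _ e]) simp
    then have "Fraction_Field.Fract (f - const_poly \<alpha> * g) g \<in> local_ideal I P"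
      using Fract_in_local_ideal_iff[OF ideal g] by blast
    then show ?thesis using g by (auto simp: u eval_nonzero_imp_nonzero)
  qed
  have uniq: "\<alpha> = \<alpha>'" if "u - Fraction_Field.Fract (const_poly \<alpha>) 1 \<in> local_ideal I P"
    "u - Fraction_Field.Fract (const_poly \<alpha>') 1 \<in> local_ideal I P" for u \<alpha> \<alpha>'
  proof -
    have "Fraction_Field.Fract (const_poly \<alpha> - const_poly \<alpha>') 1 \<in> local_ideal I P"
      using loc.subspace_diff[OF loc.subspace_W that(2,1)] by simp
    then obtain s where s: "eval_zw P s \<noteq> 0" "s * (const_poly \<alpha> - const_poly \<alpha>') \<in> I"
      using Fract_in_local_ideal_iff[OF ideal, of P 1] by auto
    then have "eval_zw P (s * (const_poly \<alpha> - const_poly \<alpha>')) = 0" using P unfolding zero_set_def by blast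
    then show ?thesis using s(1) by simp
  qed
  have "basis_mod scale_fract (local_ring P) (local_ideal I P) [1]"
    unfolding basis_mod_def lin
  proof (intro conjI ballI)
    show "set [1] \<subseteq> local_ring P"
      using Fract_1_in_local_ring by (simp add: One_fract_def)
    fix u assume "u \<in> local_ring P"
    from ex[OF this] obtain \<alpha> where \<alpha>: "u - Fraction_Field.Fract (const_poly \<alpha>) 1 \<in> local_ideal I P" by blast
    show "\<exists>!v. v \<in> carrier_vec (length [1]) \<and> u - Fraction_Field.Fract (const_poly (v $ 0)) 1 \<in> local_ideal I P"
    proof (intro ex1I[of _ "vec 1 (\<lambda>_. \<alpha>)"])
      fix v assume v: "v \<in> carrier_vec (length [1]) \<and> u - Fraction_Field.Fract (const_poly (v $ 0)) 1 \<in> local_ideal I P"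
      then have "v $ 0 = \<alpha>" using uniq \<alpha> by blast
      then show "v = vec 1 (\<lambda>_. \<alpha>)" using v by (intro eq_vecI) auto
    qed (use \<alpha> in simp)
  qed
  from loc.dim_mod_eq_length[OF this] show ?thesis by (simp add: multiplicity_at_def)
qed

text \<open>
  If \<open>f\<close> vanishes on \<open>V\<close> and all multiplicities are \<open>1\<close>, the ideal of all \<open>s\<close> with \<open>s f \<in> I\<close> has no zero
  in \<open>V\<close>, so it contains \<open>1\<close>.
\<close>

theorem multiplicities_1_iff_radical:
  "(\<forall>P\<in>V. multiplicity_at I P = 1) \<longleftrightarrow> (\<forall>f. (\<forall>P\<in>V. eval_zw P f = 0) \<longrightarrow> f \<in> I)"
proof (intro iffI allI impI ballI)
  fix f assume mult: "\<forall>P\<in>V. multiplicity_at I P = 1" and f: "\<forall>P\<in>V. eval_zw P f = 0"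
  define J where "J = {s. s * f \<in> I}"
  have J: "is_ideal J" "I \<subseteq> J"
    using is_ideal_0[OF ideal] is_ideal_add[OF ideal] is_ideal_mult[OF ideal] is_ideal_mult_right[OF ideal]
    by (auto simp: is_ideal_def J_def distrib_right mult.assoc)
  show "f \<in> I"
  proof (rule ccontr)
    assume "f \<notin> I"
    then have "1 \<notin> J" by (simp add: J_def)
    from weak_nullstellensatz[OF J this] obtain P where P: "\<And>s. s \<in> J \<Longrightarrow> eval_zw P s = 0" by blast
    then have "P \<in> V" using J(2) by (auto simp: zero_set_def)
    with mult f local_factor_if_multiplicity_1 obtain s where "eval_zw P s \<noteq> 0" "s * f \<in> I" by blast
    then show False using P by (auto simp: J_def)
  qed
next
  fix P assume "\<forall>f. (\<forall>P\<in>V. eval_zw P f = 0) \<longrightarrow> f \<in> I" "P \<in> V"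
  then show "multiplicity_at I P = 1" by (intro multiplicity_1_if_radical) auto
qed

end

section \<open>Rank, signature and definiteness of the Killing form\<close>

text \<open>
  The involution permutes the generators.
\<close>

lemma star_tilde_ideal:
  assumes "f \<in> tilde_ideal c p"
  shows "star f \<in> tilde_ideal c p"
proof -
  define G where "G = p ` {..<c} \<union> (\<lambda>i. star (p i)) ` {..<c}"
  have span: "tilde_ideal c p = Modules.module.span (*) G"
    by (simp add: tilde_ideal_def ideal_generated_def G_def)
  from assms show ?thesis unfolding span
  proof (rule Modules.module.span_induct_alt[OF module_times, where h = "\<lambda>f. star f \<in> Modules.module.span (*) G"])
    show "star 0 \<in> Modules.module.span (*) G"
      by (simp add: Modules.module.span_zero[OF module_times])
    fix a x y assume x: "x \<in> G" and y: "star y \<in> Modules.module.span (*) G"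
    have "star x \<in> G" using x by (auto simp: G_def)
    then have "star a * star x \<in> Modules.module.span (*) G"
      by (intro Modules.module.span_scale[OF module_times] Modules.module.span_base[OF module_times])
    then show "star (a * x + y) \<in> Modules.module.span (*) G"
      unfolding star_add star_mult by (rule Modules.module.span_add[OF module_times _ y])
  qed
qed

theorem theorem3p13:
  fixes c :: nat
    and p :: "nat \<Rightarrow> 'r::{finite,linorder} zw_poly"
    and I :: "'r zw_poly set"
    and \<xi> :: "'r zw_poly"
    and bs :: "'r zw_poly list"
  assumes "1 \<le> c"
    and "I = tilde_ideal c p"
    and "zero_dimensional I"
    and "star \<xi> = \<xi>"
    and "quotient_basis I bs"
  shows
    "((\<forall>P\<in>zero_set I. conjugated_single P \<and> multiplicity_at I P = 1 \<and> 0 < eval_zw P \<xi>)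
        \<longleftrightarrow> positive_definite_mod I (killing_form I \<xi>))
     \<and> form_rank bs (killing_form I \<xi>) = card {P \<in> zero_set I. eval_zw P \<xi> \<noteq> 0}
     \<and> int (card {P \<in> zero_set I. conjugated_single P \<and> 0 < eval_zw P \<xi>})
         - int (card {P \<in> zero_set I. conjugated_single P \<and> eval_zw P \<xi> < 0})
       = signature_of_form bs (killing_form I \<xi>)
     \<and> (inj_on (\<lambda>P. eval_zw P \<xi>) (zero_set I) \<longrightarrow>
         int (card {P \<in> zero_set I. conjugated_single P \<and> 0 < eval_zw P \<xi>})
           = int (num_pos_eigenvalues bs (killing_form I \<xi>))
             - int (num_neg_eigenvalues bs (killing_form I 1))
         \<and> int (card {P \<in> zero_set I. conjugated_single P \<and> eval_zw P \<xi> < 0})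
           = int (num_neg_eigenvalues bs (killing_form I \<xi>))
             - int (num_neg_eigenvalues bs (killing_form I 1)))"
proof -
  have ideal: "is_ideal I" unfolding assms(2) tilde_ideal_def by (rule is_ideal_generated)
  have star_I: "star f \<in> I" if "f \<in> I" for f
    using that unfolding assms(2) by (rule star_tilde_ideal)
  interpret zero_dim_ideal_local I bs
    by unfold_locales (rule ideal, rule assms(5))
  interpret star_invariant_zero_dim_ideal I bs
    by unfold_locales (rule star_I)
  interpret K: hermitian_killing_form I bs \<xi> by unfold_locales (rule assms(4))
  interpret K1: hermitian_killing_form I bs 1 by unfold_locales simp
  have definite: "(\<forall>P\<in>V. conjugated_single P \<and> multiplicity_at I P = 1 \<and> 0 < eval_zw P \<xi>)
      \<longleftrightarrow> positive_definite_mod I (killing_form I \<xi>)"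
    unfolding K.positive_definite_iff multiplicities_1_iff_radical[symmetric] by blast
  have signature: "int (card {P \<in> V. conjugated_single P \<and> 0 < eval_zw P \<xi>})
      - int (card {P \<in> V. conjugated_single P \<and> eval_zw P \<xi> < 0}) = signature_of_form bs (killing_form I \<xi>)"
    by (simp add: signature_of_form_def K.killing_form_inertia(2,3))
  have no_neg: "{P \<in> V. conjugated_single P \<and> eval_zw P 1 < 0} = {}"
    by (auto simp: less_complex_def)
  \<comment> \<open>If \<open>\<xi>\<close> separates the zeros, it cannot take the real value \<open>0\<close> at a point of a pair.\<close>
  have same: "{P \<in> V. P \<in> pair_representatives \<and> eval_zw P \<xi> \<noteq> 0} = {P \<in> V. P \<in> pair_representatives \<and> eval_zw P 1 \<noteq> 0}"
    if inj: "inj_on (\<lambda>P. eval_zw P \<xi>) V"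
  proof -
    have "eval_zw P \<xi> \<noteq> 0" if "P \<in> V" "P \<in> pair_representatives" for P
    proof
      assume "eval_zw P \<xi> = 0"
      then have "eval_zw (conj_point P) \<xi> = eval_zw P \<xi>" by (simp add: K.eval_\<xi>_conj_point)
      then have "conj_point P = P" using inj that(1) by (auto dest: inj_onD)
      then show False using that(2) by (simp add: pair_representatives_def)
    qed
    then show ?thesis by auto
  qed
  show ?thesis
  proof (intro conjI impI)
    assume inj: "inj_on (\<lambda>P. eval_zw P \<xi>) V"
    show "int (card {P \<in> V. conjugated_single P \<and> 0 < eval_zw P \<xi>})
        = int (num_pos_eigenvalues bs (killing_form I \<xi>)) - int (num_neg_eigenvalues bs (killing_form I 1))"
      unfolding K.killing_form_inertia(2) K1.killing_form_inertia(3) no_neg same[OF inj] by simp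
    show "int (card {P \<in> V. conjugated_single P \<and> eval_zw P \<xi> < 0})
        = int (num_neg_eigenvalues bs (killing_form I \<xi>)) - int (num_neg_eigenvalues bs (killing_form I 1))"
      unfolding K.killing_form_inertia(3) K1.killing_form_inertia(3) no_neg same[OF inj] by simp
  qed (rule definite K.killing_form_inertia(1) signature)+
qed

end
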